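(* Let $k\ge 2$ be an integer. For every admissible index $\boldsymbol{k}$ of weight $k$ there exist integers $c_{\boldsymbol{k};\boldsymbol{l}}\in\mathbb{Z}$ ($\boldsymbol{l}\in\mathbb{I}^{\ge2}_k$) such that \[ \zeta(\boldsymbol{k})=\sum_{\boldsymbol{l}\in\mathbb{I}^{\geq 2}_k}c_{\boldsymbol{k};\boldsymbol{l}}\,\zeta(\boldsymbol{l}). \] In particular, \[ \operatorname{span}_{\mathbb{Z}}\{\zeta(\boldsymbol{k})\mid \boldsymbol{k}\in\mathbb{I}^{\mathrm{adm}}_k\}=\operatorname{span}_{\mathbb{Z}}\{\zeta(\boldsymbol{k})\mid \boldsymbol{k}\in\mathbb{I}^{\geq 2}_k\}. \]
   Context: An index is a finite tuple $\boldsymbol{k}=(k_1,\dots,k_r)$ of positive integers; its weight is $k_1+\cdots+k_r$ and its depth is $r$. It is admissible if $r\ge1$ and $k_r\ge2$. For an admissible index, the multiple zeta value is $\zeta(\boldsymbol{k})=\sum_{0<n_1<\cdots<n_r}n_1^{-k_1}\cdots n_r^{-k_r}$. $\mathbb{I}^{\mathrm{adm}}_k$ denotes the set of admissible indices of weight $k$, and $\mathbb{I}^{\ge2}_k$ the set of indices $(k_1,\dots,k_r)$ of weight $k$ with all $k_i\ge2$. *)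

theory Defs
  imports "HOL-Analysis.Analysis"
begin

definition is_index :: "nat list \<Rightarrow> bool" where
  "is_index ks \<longleftrightarrow> (\<forall>x\<in>set ks. x > 0)"

definition admissible :: "nat list \<Rightarrow> bool" where
  "admissible ks \<longleftrightarrow> is_index ks \<and> ks \<noteq> [] \<and> last ks \<ge> 2"

definition mzv :: "nat list \<Rightarrow> real" where
  "mzv ks = infsum (\<lambda>ns. \<Prod>i<length ks. 1 / real (ns ! i) ^ (ks ! i))
      {ns. length ns = length ks \<and> sorted_wrt (<) ns \<and> (\<forall>n\<in>set ns. n > 0)}"

definition Iadm :: "nat \<Rightarrow> nat list set" where
  "Iadm k = {ks. admissible ks \<and> sum_list ks = k}"

definition Ige2 :: "nat \<Rightarrow> nat list set" where
  "Ige2 k = {ks. (\<forall>x\<in>set ks. x \<ge> 2) \<and> sum_list ks = k}"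

definition zspan :: "nat list set \<Rightarrow> real set" where
  "zspan A = {\<Sum>a\<in>A. of_int (c a) * mzv a | c :: nat list \<Rightarrow> int. True}"

end

theory Submission
  imports Defs "HOL-Real_Asymp.Real_Asymp"
begin

text \<open>
  Encode an index as a word by \<open>k\<^sub>1, \<dots>, k\<^sub>r \<mapsto> Y X\<^bsup>k\<^sub>1 - 1\<^esup> \<dots> Y X\<^bsup>k\<^sub>r - 1\<^esup>\<close> and consider, in
  noncommutative power series, the products over \<open>n = 1, \<dots>, N - 1\<close> (in this order) of
  \<open>(1 + Y/(N - n)) (1 - X/n)\<^sup>-\<^sup>1\<close> and of \<open>(1 - Y/(N - n))\<^sup>-\<^sup>1 (1 - X/n)\<^sup>-\<^sup>1\<close>. The coefficients of the
  first product are exactly the truncated multiple zeta values (the discretisation of Maesaka, Seki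
  and Watanabe), and on admissible words the two products have the same limit as \<open>N \<rightarrow> \<infinity>\<close>.

  Passing from \<open>N\<close> to \<open>N + 1\<close> exchanges neighbouring factors. For the second product this amounts
  to a substitution of the letters by integral series, homogeneous in \<open>1/N\<close>, and multiplication by
  outer factors. On admissible words the resulting difference equation is closed and has no term of
  order \<open>1/N\<close>, so that summing it expresses every coefficient integrally through truncated sums of
  indices with all entries at least \<open>2\<close>.
\<close>


section \<open>Noncommutative power series in two letters\<close>

datatype letter = X | Y

text \<open>A separate type, so that \<open>*\<close> can be convolution along the splittings of a
  word and \<open>real_algebra_1\<close> supplies the ring laws.\<close>

typedef ncs = "UNIV :: (letter list \<Rightarrow> real) set"
  morphisms cf Abs_ncs by simp

lemma cf_Abs [simp]: "cf (Abs_ncs f) = f"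
  by (simp add: Abs_ncs_inverse)

lemma ncs_eqI: "(\<And>w. cf f w = cf g w) \<Longrightarrow> f = g"
  by (metis cf_inject ext)

instantiation ncs :: real_algebra_1
begin

definition "0 = Abs_ncs (\<lambda>w. 0)"
definition "1 = Abs_ncs (\<lambda>w. if w = [] then 1 else 0)"
definition "f + g = Abs_ncs (\<lambda>w. cf f w + cf g w)"
definition "f - g = Abs_ncs (\<lambda>w. cf f w - cf g w)"
definition "- f = Abs_ncs (\<lambda>w. - cf f w)"
definition "c *\<^sub>R f = Abs_ncs (\<lambda>w. c * cf f w)"
definition "f * g = Abs_ncs (\<lambda>w. \<Sum>i=0..length w. cf f (take i w) * cf g (drop i w))"

instance
proof
  fix f g h :: ncs and c d :: real
  show "f * g * h = f * (g * h)"
  proof (rule ncs_eqI)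
    fix w
    \<comment> \<open>The three pieces of \<open>w\<close> are indexed by their lengths
      \<open>i\<close>, \<open>j\<close>, \<open>k\<close>; in this form the reindexing for formal
      power series in one variable applies.\<close>
    let ?F = "\<lambda>i j k. cf f (take i w) * cf g (take j (drop i w)) * cf h (drop (length w - k) w)"
    have "cf (f * g * h) w = (\<Sum>j=0..length w. \<Sum>i=0..j. ?F i (j - i) (length w - j))"
      by (auto simp: times_ncs_def sum_distrib_right min.absorb1 min.absorb2 take_drop intro!: sum.cong)
    also have "\<dots> = (\<Sum>j=0..length w. \<Sum>i=0..length w - j. ?F j i (length w - j - i))"
      by (rule fps_mult_assoc_lemma)
    also have "\<dots> = cf (f * (g * h)) w"
      by (auto simp: times_ncs_def sum_distrib_left mult.assoc add.commute intro!: sum.cong)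
    finally show "cf (f * g * h) w = cf (f * (g * h)) w" .
  qed
  show "1 * f = f"
  proof (rule ncs_eqI)
    fix w
    have "cf (1 * f) w = (\<Sum>i\<in>{0..length w}. if i = 0 then cf f w else 0)"
      unfolding times_ncs_def one_ncs_def cf_Abs by (rule sum.cong) auto
    then show "cf (1 * f) w = cf f w" by simp
  qed
  show "f * 1 = f"
  proof (rule ncs_eqI)
    fix w
    have "cf (f * 1) w = (\<Sum>i=0..length w. if i = length w then cf f w else 0)"
      unfolding times_ncs_def one_ncs_def cf_Abs
    proof (rule sum.cong)
      fix i assume "i \<in> {0..length w}"
      then show "cf f (take i w) * (if drop i w = [] then 1 else 0) = (if i = length w then cf f w else 0)"
        by (cases "i = length w") simp_all
    qed simp
    then show "cf (f * 1) w = cf f w" by simp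
  qed
  show "(f + g) * h = f * h + g * h"
    by (auto simp: times_ncs_def plus_ncs_def distrib_right sum.distrib)
  show "f * (g + h) = f * g + f * h"
    by (auto simp: times_ncs_def plus_ncs_def distrib_left sum.distrib)
  show "(0::ncs) \<noteq> 1"
    using arg_cong[where f = "\<lambda>f. cf f []" and x = "0::ncs" and y = 1] unfolding zero_ncs_def one_ncs_def cf_Abs by auto
  show "c *\<^sub>R f * g = c *\<^sub>R (f * g)"
    by (auto simp: times_ncs_def scaleR_ncs_def sum_distrib_left mult.assoc)
  show "f * c *\<^sub>R g = c *\<^sub>R (f * g)"
    by (auto simp: times_ncs_def scaleR_ncs_def sum_distrib_left mult.left_commute)
qed (auto simp: zero_ncs_def plus_ncs_def minus_ncs_def uminus_ncs_def scaleR_ncs_def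
      algebra_simps cf_inverse)

end

lemma cf_simps [simp]:
  "cf 0 w = 0" "cf 1 w = (if w = [] then 1 else 0)"
  "cf (f + g) w = cf f w + cf g w" "cf (f - g) w = cf f w - cf g w"
  "cf (- f) w = - cf f w" "cf (c *\<^sub>R f) w = c * cf f w"
  by (simp_all add: zero_ncs_def one_ncs_def plus_ncs_def minus_ncs_def uminus_ncs_def
      scaleR_ncs_def)

lemma cf_mult: "cf (f * g) w = (\<Sum>i=0..length w. cf f (take i w) * cf g (drop i w))"
  by (simp add: times_ncs_def)

lemma cf_sum: "cf (\<Sum>i\<in>I. f i) w = (\<Sum>i\<in>I. cf (f i) w)"
  by (induction I rule: infinite_finite_induct) auto

lemma cf_mult_Nil [simp]: "cf (f * g) [] = cf f [] * cf g []"
  by (simp add: cf_mult)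

definition var :: "letter \<Rightarrow> ncs" where
  "var l = Abs_ncs (\<lambda>w. if w = [l] then 1 else 0)"

lemma cf_var [simp]: "cf (var l) w = (if w = [l] then 1 else 0)"
  by (simp add: var_def)

lemma cf_mult_var_snoc [simp]: "cf (f * var l) (w @ [m]) = (if l = m then cf f w else 0)"
proof -
  have "cf (f * var l) (w @ [m]) = (\<Sum>i=0..Suc (length w). if i = length w then (if l = m then cf f w else 0) else 0)"
    unfolding cf_mult
  proof (rule sum.cong)
    fix i assume "i \<in> {0..Suc (length w)}"
    then consider "i < length w" | "i = length w" | "i = Suc (length w)" by force
    then show "cf f (take i (w @ [m])) * cf (var l) (drop i (w @ [m])) = (if i = length w then (if l = m then cf f w else 0) else 0)"
      by cases (auto dest!: arg_cong[of _ _ length])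
  qed simp
  also have "\<dots> = (if l = m then cf f w else 0)"
    by (subst sum.delta) auto
  finally show ?thesis .
qed

lemma cf_var_mult_Cons [simp]: "cf (var l * f) (m # w) = (if l = m then cf f w else 0)"
proof -
  have "cf (var l * f) (m # w) = (\<Sum>i=0..Suc (length w). if i = 1 then (if l = m then cf f w else 0) else 0)"
    unfolding cf_mult
  proof (rule sum.cong)
    fix i assume "i \<in> {0..Suc (length w)}"
    then consider "i = 0" | "i = 1" | j where "i = Suc (Suc j)" "Suc j \<le> length w"
      by (metis One_nat_def atLeastAtMost_iff nat.exhaust not_less_eq_eq)
    then show "cf (var l) (take i (m # w)) * cf f (drop i (m # w)) = (if i = 1 then (if l = m then cf f w else 0) else 0)"
      by cases (auto simp: take_Suc_conv_app_nth dest!: arg_cong[of _ _ length])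
  qed simp
  also have "\<dots> = (if l = m then cf f w else 0)"
    by (subst sum.delta) auto
  finally show ?thesis .
qed

section \<open>Filtration by word length and geometric series\<close>

definition vanish :: "nat \<Rightarrow> ncs \<Rightarrow> bool" where
  "vanish n f \<longleftrightarrow> (\<forall>w. length w < n \<longrightarrow> cf f w = 0)"

lemma vanish_mult:
  assumes "vanish m f" "vanish n g"
  shows "vanish (m + n) (f * g)"
  unfolding vanish_def
proof (intro allI impI)
  fix w :: "letter list" assume "length w < m + n"
  then have "length (take i w) < m \<or> length (drop i w) < n" if "i \<in> {0..length w}" for i
    using that by auto
  then show "cf (f * g) w = 0"
    using assms unfolding cf_mult vanish_def by (intro sum.neutral) (metis mult_eq_0_iff)
qed

lemma vanish_0 [simp]: "vanish 0 f" "vanish n 0"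
  by (auto simp: vanish_def)

lemma vanish_mono: "vanish n f \<Longrightarrow> m \<le> n \<Longrightarrow> vanish m f"
  by (auto simp: vanish_def)

lemma vanish_add: "vanish n f \<Longrightarrow> vanish n g \<Longrightarrow> vanish n (f + g)"
  and vanish_diff: "vanish n f \<Longrightarrow> vanish n g \<Longrightarrow> vanish n (f - g)"
  and vanish_scaleR: "vanish n f \<Longrightarrow> vanish n (c *\<^sub>R f)"
  by (auto simp: vanish_def)

lemma vanish_var: "vanish 1 (var l)"
  by (auto simp: vanish_def)

lemma vanish_1_iff: "vanish 1 f \<longleftrightarrow> cf f [] = 0"
  by (auto simp: vanish_def)

lemma vanish_power: "vanish 1 h \<Longrightarrow> vanish k (h ^ k)"
proof (induction k)
  case (Suc k)
  then show ?case using vanish_mult[of 1 h k "h ^ k"] by simp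
qed simp

text \<open>The inverse of \<open>1 - h\<close>, meant for \<open>h\<close> without constant term:
  then \<open>h ^ k\<close> starts at length \<open>k\<close>, so cutting the sum at the length of
  \<open>w\<close> loses nothing.\<close>

definition geo :: "ncs \<Rightarrow> ncs" where
  "geo h = Abs_ncs (\<lambda>w. \<Sum>k\<le>length w. cf (h ^ k) w)"

lemma cf_geo_ge:
  assumes "vanish 1 h" "length w \<le> n"
  shows "cf (geo h) w = cf (\<Sum>k\<le>n. h ^ k) w"
proof -
  have "(\<Sum>k\<le>length w. cf (h ^ k) w) = (\<Sum>k\<le>n. cf (h ^ k) w)"
    using assms vanish_power[OF assms(1)]
    by (intro sum.mono_neutral_left) (auto simp: vanish_def)
  then show ?thesis by (simp add: geo_def cf_sum)
qed

text \<open>The partial sums telescope to \<open>1 - h ^ Suc n\<close>. Both the power and the tail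
  of the series have order above \<open>n\<close>, so taking \<open>n = length w\<close> settles the
  coefficient at \<open>w\<close>.\<close>

lemma geo_inverse:
  assumes "vanish 1 h"
  shows geo_right: "(1 - h) * geo h = 1" and geo_left: "geo h * (1 - h) = 1"
proof -
  define S where "S = (\<lambda>n. \<Sum>k\<le>n. h ^ k)"
  have d: "vanish (Suc n) (geo h - S n)" for n
    using cf_geo_ge[OF assms] by (auto simp: vanish_def S_def)
  have S1: "(1 - h) * S n = 1 - h ^ Suc n" for n
  proof (induction n)
    case (Suc n)
    have "(1 - h) * S (Suc n) = (1 - h) * S n + (1 - h) * h ^ Suc n"
      by (simp add: S_def distrib_left)
    then show ?case by (simp only: Suc.IH) (simp add: left_diff_distrib)
  qed (simp add: S_def)
  have S2: "S n * (1 - h) = 1 - h ^ Suc n" for n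
  proof (induction n)
    case (Suc n)
    have "S (Suc n) * (1 - h) = S n * (1 - h) + h ^ Suc n * (1 - h)"
      by (simp add: S_def distrib_right)
    then show ?case by (simp only: Suc.IH) (simp add: right_diff_distrib power_commutes mult.assoc)
  qed (simp add: S_def)
  have v: "vanish (Suc n) (h ^ Suc n)" for n
    using vanish_power[OF assms] .
  show "(1 - h) * geo h = 1"
  proof (rule ncs_eqI)
    fix w :: "letter list"
    have "(1 - h) * geo h = (1 - h) * (geo h - S (length w)) + (1 - h ^ Suc (length w))"
      by (subst S1[symmetric]) (simp add: algebra_simps)
    moreover have "vanish (Suc (length w)) ((1 - h) * (geo h - S (length w)))"
      using vanish_mult[OF vanish_0(1) d] by simp
    ultimately show "cf ((1 - h) * geo h) w = cf 1 w"
      using v[of "length w"] by (auto simp: vanish_def)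
  qed
  show "geo h * (1 - h) = 1"
  proof (rule ncs_eqI)
    fix w :: "letter list"
    have "geo h * (1 - h) = (geo h - S (length w)) * (1 - h) + (1 - h ^ Suc (length w))"
      by (subst S2[symmetric]) (simp add: algebra_simps)
    moreover have "vanish (Suc (length w)) ((geo h - S (length w)) * (1 - h))"
      using vanish_mult[OF d vanish_0(1)] by simp
    ultimately show "cf (geo h * (1 - h)) w = cf 1 w"
      using v[of "length w"] by (auto simp: vanish_def)
  qed
qed

lemma inverse_unique_ring:
  fixes f g h :: "'a::ring_1"
  assumes "g * f = 1" "f * h = 1"
  shows "g = h"
  by (metis assms mult.assoc mult_1_left mult_1_right)

section \<open>A substitution exchanging neighbouring geometric series\<close>

text \<open>Pascal's rule, written as removal of a last \<open>Y\<close> or of a first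
  \<open>X\<close>. This makes the functional equation of the generating series immediate and gives
  0 on every word not of the form \<open>X \<dots> X Y \<dots> Y\<close>.\<close>

function binom_coef :: "letter list \<Rightarrow> real" where
  "binom_coef w = (if w = [] then 1 else
     (if last w = Y then binom_coef (butlast w) else 0) + (if hd w = X then binom_coef (tl w) else 0))"
  by auto
termination by (relation "Wellfounded.measure length") auto

declare binom_coef.simps [simp del]

definition binom_series :: ncs where "binom_series = Abs_ncs binom_coef"

lemma binom_series_eq: "binom_series = 1 + binom_series * var Y + var X * binom_series"
proof (rule ncs_eqI)
  fix w
  show "cf binom_series w = cf (1 + binom_series * var Y + var X * binom_series) w"
  proof (cases "w = []")
    case False
    have "cf (binom_series * var Y) w = (if last w = Y then binom_coef (butlast w) else 0)"
      using cf_mult_var_snoc[of binom_series Y "butlast w" "last w"] False by (auto simp: binom_series_def)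
    moreover have "cf (var X * binom_series) w = (if hd w = X then binom_coef (tl w) else 0)"
      using cf_var_mult_Cons[of X binom_series "hd w" "tl w"] False by (auto simp: binom_series_def)
    ultimately show ?thesis
      using False by (simp add: binom_series_def binom_coef.simps[of w])
  qed (simp add: binom_series_def binom_coef.simps)
qed

definition binom_inverse :: ncs where "binom_inverse = geo (1 - binom_series)"

lemma binom_inverse_left: "binom_inverse * binom_series = 1" and binom_inverse_right: "binom_series * binom_inverse = 1"
proof -
  have "vanish 1 (1 - binom_series)"
    unfolding vanish_1_iff by (simp add: binom_series_def binom_coef.simps)
  from geo_inverse[OF this] show "binom_inverse * binom_series = 1" "binom_series * binom_inverse = 1"
    by (simp_all add: binom_inverse_def)
qed

text \<open>
  The series \<open>b = binom_series\<close> is the sum of all \<open>(i + j choose i) X\<^sup>i Y\<^sup>j\<close>.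
  The substitution \<open>Y \<mapsto> b Y b\<^sup>-\<^sup>1\<close>, \<open>X \<mapsto> b\<^sup>-\<^sup>1 X b\<close> shifts both letters by the
  same series \<open>u\<close> (\<open>subst_var_diff\<close>), and \<open>X + u\<close>, \<open>1 - Y - u\<close> have the same sum as
  \<open>X\<close>, \<open>1 - Y\<close> but the product of these in reverse order. This is what makes it turn
  \<open>(1 - cY)\<^sup>-\<^sup>1 (1 - dX)\<^sup>-\<^sup>1\<close> with \<open>1/c + 1/d = 1\<close> into the product in the opposite order.
\<close>

definition subst_var :: "letter \<Rightarrow> ncs" where
  "subst_var l = (case l of X \<Rightarrow> binom_inverse * var X * binom_series | Y \<Rightarrow> binom_series * var Y * binom_inverse)"

lemma vanish_subst_var: "vanish 1 (subst_var l)"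
  unfolding vanish_1_iff by (cases l) (simp_all add: subst_var_def)

text \<open>With \<open>b\<close> the binomial series, \<open>b * (1 - Y) = 1 + X * b\<close>.
  Multiplying by the inverse of \<open>b\<close> on the right expresses \<open>subst_var Y\<close>,
  on the left \<open>subst_var X\<close>; the inverse cancels in the comparison.\<close>

lemma subst_var_diff: "subst_var X - var X = subst_var Y - var Y"
proof -
  have 1: "binom_series * (1 - var Y) = 1 + var X * binom_series"
    using binom_series_eq by (simp add: algebra_simps)
  have "(binom_series * (1 - var Y)) * binom_inverse = binom_inverse + var X"
    unfolding 1 by (simp add: distrib_right mult.assoc binom_inverse_right)
  then have A: "1 - subst_var Y = binom_inverse + var X"
    by (simp add: subst_var_def right_diff_distrib left_diff_distrib mult.assoc binom_inverse_right)
  have "binom_inverse * (binom_series * (1 - var Y)) = binom_inverse + subst_var X"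
    unfolding 1 by (simp add: distrib_left subst_var_def mult.assoc)
  then have B: "1 - var Y = binom_inverse + subst_var X"
    by (simp add: mult.assoc[symmetric] binom_inverse_left)
  have "subst_var X = 1 - var Y - binom_inverse" by (simp add: B)
  moreover have "subst_var Y = 1 - (binom_inverse + var X)" by (simp add: A[symmetric])
  ultimately show ?thesis by simp
qed

text \<open>After the inner conjugations cancel, the point is that \<open>X * b\<close> commutes
  with \<open>1 + X * b\<close>, which equals \<open>b * (1 - Y)\<close>.\<close>

lemma subst_var_XY: "subst_var X * (1 - subst_var Y) = (1 - var Y) * var X"
proof -
  have 1: "binom_series * (1 - var Y) = 1 + var X * binom_series"
    using binom_series_eq by (simp add: algebra_simps)
  have "1 - subst_var Y = binom_series * (1 - var Y) * binom_inverse"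
    by (simp add: subst_var_def right_diff_distrib left_diff_distrib mult.assoc binom_inverse_right)
  then have "subst_var X * (1 - subst_var Y) = binom_inverse * var X * binom_series * ((1 + var X * binom_series) * binom_inverse)"
    using 1 by (simp add: subst_var_def)
  also have "\<dots> = binom_inverse * ((1 + var X * binom_series) * (var X * (binom_series * binom_inverse)))"
    by (simp add: algebra_simps)
  also have "\<dots> = binom_inverse * (binom_series * (1 - var Y)) * var X"
    using 1 by (simp add: binom_inverse_right mult.assoc)
  also have "\<dots> = (1 - var Y) * var X"
    by (simp add: mult.assoc[symmetric] binom_inverse_left)
  finally show ?thesis .
qed

lemma subst_var_YX: "(1 - subst_var X) * subst_var Y = var Y * (1 - var X)"
proof -
  have a: "subst_var Y = var Y + subst_var X - var X" using subst_var_diff by (simp add: algebra_simps)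
  have ba: "subst_var X * subst_var Y = subst_var X - var X + var Y * var X"
    using subst_var_XY by (simp add: algebra_simps)
  have "(1 - subst_var X) * subst_var Y = subst_var Y - subst_var X * subst_var Y"
    by (simp add: left_diff_distrib)
  also have "\<dots> = var Y * (1 - var X)"
    unfolding ba by (subst a) (simp add: right_diff_distrib)
  finally show ?thesis .
qed

text \<open>The common shift \<open>u\<close> of both letters satisfies the Riccati equation
  \<open>u = (X * Y - Y * X) + X * u + u * Y + u * u\<close>. Feeding it into itself raises the
  known order of \<open>u\<close> from 1 to 2, and then that of the remainder to 3.\<close>

lemma subst_var_expand:
  "vanish 3 (subst_var l - var l - (var X * var Y - var Y * var X))"
proof -
  define u where "u = subst_var X - var X"
  have uX: "subst_var X = var X + u" and uY: "subst_var Y = var Y + u"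
    using subst_var_diff by (simp_all add: u_def algebra_simps)
  have ric: "u = (var X * var Y - var Y * var X) + var X * u + u * var Y + u * u"
    using subst_var_XY unfolding uX uY by (simp add: algebra_simps)
  have 1: "vanish 1 u"
    unfolding u_def using vanish_subst_var vanish_var by (rule vanish_diff)
  have rest: "vanish (k + 1) (var X * u + u * var Y + u * u)" if "vanish k u" for k
    using vanish_mult[OF vanish_var that, of X] vanish_mult[OF that vanish_var, of Y]
      vanish_mult[OF that 1]
    by (intro vanish_add) (simp_all add: add.commute)
  have "vanish 2 (var l * var l')" for l l'
    using vanish_mult[OF vanish_var vanish_var] by (simp add: numeral_2_eq_2)
  then have "vanish 2 ((var X * var Y - var Y * var X) + (var X * u + u * var Y + u * u))"
    using rest[OF 1] by (intro vanish_add[of 2 "_ - _"] vanish_diff) (simp_all add: numeral_2_eq_2)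
  then have "vanish 2 u" by (subst ric) (simp add: add.assoc)
  then have "vanish 3 (var X * u + u * var Y + u * u)"
    using rest by fastforce
  moreover have "u - (var X * var Y - var Y * var X) = var X * u + u * var Y + u * u"
    by (subst (1) ric) (simp add: algebra_simps)
  ultimately have "vanish 3 (u - (var X * var Y - var Y * var X))" by simp
  moreover have "subst_var l - var l = u"
    using uX uY by (cases l) simp_all
  ultimately show ?thesis by simp
qed

section \<open>Substitution in words and in series\<close>

definition word :: "letter list \<Rightarrow> ncs" where "word u = prod_list (map var u)"
definition subst_word :: "letter list \<Rightarrow> ncs" where "subst_word u = prod_list (map subst_var u)"

lemma cf_word: "cf (word u) w = (if w = u then 1 else 0)"
proof (induction u arbitrary: w)
  case (Cons l u)
  show ?case
  proof (cases w)
    case (Cons m v)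
    then show ?thesis using Cons.IH by (simp add: word_def)
  qed (simp add: word_def)
qed (simp add: word_def)

lemma vanish_word: "vanish (length u) (word u)"
  by (auto simp: vanish_def cf_word)

lemma vanish_subst_word: "vanish (length u) (subst_word u)"
proof (induction u)
  case (Cons l u)
  then show ?case using vanish_mult[OF vanish_subst_var[of l] Cons] by (simp add: subst_word_def)
qed simp

text \<open>For either letter \<open>l\<close> the commutator of \<open>X - Y\<close> with
  \<open>l\<close> is \<open>X * Y - Y * X\<close>. So the first-order term is a derivation, and the
  induction on the word is its Leibniz rule; all other products have higher order.\<close>

lemma subst_word_expand:
  "vanish (length u + 2) (subst_word u - word u - ((var X - var Y) * word u - word u * (var X - var Y)))"
proof (induction u)
  case Nil
  then show ?case by (simp add: subst_word_def word_def)
next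
  case (Cons l u)
  define z where "z = var X - var Y"
  define r where "r = subst_var l - var l - (z * var l - var l * z)"
  define R where "R = subst_word u - word u - (z * word u - word u * z)"
  define c where "c = z * var l - var l * z"
  define C where "C = z * word u - word u * z"
  have "z * var l - var l * z = var X * var Y - var Y * var X"
    by (cases l) (simp_all add: z_def algebra_simps)
  then have r: "vanish 3 r"
    using subst_var_expand[of l] by (simp add: r_def)
  have R: "vanish (length u + 2) R"
    using Cons by (simp add: R_def z_def)
  have z: "vanish 1 z" unfolding z_def by (intro vanish_diff vanish_var)
  have c: "vanish 2 c"
    using vanish_mult[OF z vanish_var] vanish_mult[OF vanish_var z]
    unfolding c_def by (intro vanish_diff) (simp_all add: numeral_2_eq_2)
  have C: "vanish (length u + 1) C"
    using vanish_mult[OF z vanish_word[of u]] vanish_mult[OF vanish_word[of u] z]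
    unfolding C_def by (intro vanish_diff) simp_all
  have "vanish (length u + 3) (var l * R + (c * C + c * R) + r * subst_word u)"
    using vanish_mult[OF vanish_var R, of l] vanish_mult[OF c C] vanish_mult[OF c R]
      vanish_mult[OF r vanish_subst_word[of u]]
    by (intro vanish_add) (auto elim: vanish_mono)
  moreover have "subst_word (l # u) - word (l # u) - (z * word (l # u) - word (l # u) * z)
      = var l * R + (c * C + c * R) + r * subst_word u"
  proof -
    have s: "subst_word u = word u + C + R" and sl: "subst_var l = var l + c + r"
      by (simp_all add: R_def C_def r_def c_def)
    have "subst_word (l # u) = (var l + c) * (word u + C + R) + r * subst_word u"
      using s sl by (simp add: subst_word_def distrib_right)
    then show ?thesis
      by (simp add: word_def C_def c_def algebra_simps)
  qed
  ultimately show ?case by (simp add: z_def numeral_3_eq_3)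
qed

text \<open>Words longer than \<open>w\<close> cannot contribute at \<open>w\<close>, because both
  substituted letters have zero constant term; hence the finite sum.\<close>

definition subst_series :: "ncs \<Rightarrow> ncs" where
  "subst_series f = Abs_ncs (\<lambda>w. \<Sum>u | length u \<le> length w. cf f u * cf (subst_word u) w)"

lemma finite_words [simp]: "finite {u :: letter list. length u \<le> n}"
proof -
  have "finite (UNIV :: letter set)"
  proof -
    have "(UNIV :: letter set) = {X, Y}" using letter.exhaust by auto
    then show ?thesis by (metis finite.emptyI finite.insertI)
  qed
  from finite_lists_length_le[OF this, of n] show ?thesis by simp
qed

lemma subst_series_approx:
  "vanish (Suc n) (subst_series f - (\<Sum>u | length u \<le> n. cf f u *\<^sub>R subst_word u))"
  unfolding vanish_def
proof (intro allI impI)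
  fix w :: "letter list" assume "length w < Suc n"
  then have "cf (subst_series f) w = (\<Sum>u | length u \<le> n. cf f u * cf (subst_word u) w)"
    unfolding subst_series_def cf_Abs using vanish_subst_word
    by (intro sum.mono_neutral_left) (auto simp: vanish_def not_le)
  then show "cf (subst_series f - (\<Sum>u | length u \<le> n. cf f u *\<^sub>R subst_word u)) w = 0"
    by (simp add: cf_sum)
qed

lemma cf_mult_subst_mult:
  assumes "length w \<le> n"
  shows "cf (p * subst_series f * q) w = (\<Sum>u | length u \<le> n. cf f u * cf (p * subst_word u * q) w)"
proof -
  let ?S = "\<Sum>u | length u \<le> n. cf f u *\<^sub>R subst_word u"
  have "vanish (Suc n) (p * (subst_series f - ?S) * q)"
    using vanish_mult[OF vanish_mult[OF vanish_0(1) subst_series_approx] vanish_0(1)] by simp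
  then have "cf (p * subst_series f * q) w = cf (p * ?S * q) w"
    using assms by (simp add: vanish_def right_diff_distrib left_diff_distrib less_Suc_eq_le)
  then show ?thesis
    by (simp add: sum_distrib_left sum_distrib_right cf_sum)
qed

lemma subst_series_add: "subst_series (f + g) = subst_series f + subst_series g"
  and subst_series_scaleR: "subst_series (c *\<^sub>R f) = c *\<^sub>R subst_series f"
  by (auto intro!: ncs_eqI simp: subst_series_def sum.distrib distrib_right sum_distrib_left mult.assoc)

lemma subst_series_1: "subst_series 1 = 1"
proof (rule ncs_eqI)
  fix w
  have "cf (subst_series 1) w = (\<Sum>u | length (u :: letter list) \<le> length w. if u = [] then cf (subst_word []) w else 0)"
    unfolding subst_series_def cf_Abs by (rule sum.cong) auto
  then show "cf (subst_series 1) w = cf 1 w"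
    by (simp add: subst_word_def)
qed

text \<open>The series \<open>f * var l\<close> is supported on the words \<open>v @ [l]\<close>,
  and \<open>subst_word\<close> splits off the last letter.\<close>

lemma subst_series_mult_var: "subst_series (f * var l) = subst_series f * subst_var l"
proof (rule ncs_eqI)
  fix w :: "letter list"
  define n where "n = length w"
  have "cf (subst_series (f * var l)) w = (\<Sum>u | length u \<le> Suc n. cf (f * var l) u * cf (subst_word u) w)"
    using cf_mult_subst_mult[of w "Suc n" 1 "f * var l" 1] by (simp add: n_def)
  also have "\<dots> = (\<Sum>u\<in>(\<lambda>v. v @ [l]) ` {v. length v \<le> n}. cf (f * var l) u * cf (subst_word u) w)"
  proof (rule sum.mono_neutral_right)
    show "\<forall>u\<in>{u. length u \<le> Suc n} - (\<lambda>v. v @ [l]) ` {v. length v \<le> n}. cf (f * var l) u * cf (subst_word u) w = 0"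
    proof
      fix u assume u: "u \<in> {u. length u \<le> Suc n} - (\<lambda>v. v @ [l]) ` {v. length v \<le> n}"
      show "cf (f * var l) u * cf (subst_word u) w = 0"
        using u by (cases u rule: rev_cases) auto
    qed
  qed auto
  also have "\<dots> = (\<Sum>v | length v \<le> n. cf f v * cf (1 * subst_word v * subst_var l) w)"
    by (subst sum.reindex) (auto simp: inj_on_def subst_word_def)
  also have "\<dots> = cf (subst_series f * subst_var l) w"
    by (subst cf_mult_subst_mult[symmetric]) (simp_all add: n_def)
  finally show "cf (subst_series (f * var l)) w = cf (subst_series f * subst_var l) w" .
qed

text \<open>The product \<open>g\<close> on the left is characterised by
  \<open>g = f + c *\<^sub>R (g * var l)\<close>. Substitution preserves this linear equation, which
  is then solved by the geometric series in \<open>subst_var l\<close>.\<close>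

lemma subst_series_mult_geo:
  "subst_series (f * geo (c *\<^sub>R var l)) = subst_series f * geo (c *\<^sub>R subst_var l)"
proof -
  define g where "g = f * geo (c *\<^sub>R var l)"
  have "g * (1 - c *\<^sub>R var l) = f"
    unfolding g_def mult.assoc by (simp add: geo_left[OF vanish_scaleR[OF vanish_var]])
  then have "f + c *\<^sub>R (g * var l) = g" by (auto simp: right_diff_distrib)
  then have "subst_series f + c *\<^sub>R (subst_series g * subst_var l) = subst_series g"
    by (metis subst_series_add subst_series_scaleR subst_series_mult_var)
  then have "subst_series f = subst_series g * (1 - c *\<^sub>R subst_var l)"
    by (simp add: algebra_simps)
  then show ?thesis
    unfolding g_def[symmetric]
    by (simp add: mult.assoc geo_right[OF vanish_scaleR[OF vanish_subst_var]])
qed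

text \<open>Comparison of the inverses: in the expansion of \<open>(1 - d *\<^sub>R subst_var X) *
  (1 - c *\<^sub>R subst_var Y)\<close> the product of the letters and their difference are known,
  and \<open>c * d = c + d\<close> makes all occurrences of \<open>subst_var X\<close>
  cancel.\<close>

lemma geo_swap:
  assumes "c + d = c * d"
  shows "geo (c *\<^sub>R subst_var Y) * geo (d *\<^sub>R subst_var X) = geo (d *\<^sub>R var X) * geo (c *\<^sub>R var Y)"
proof -
  let ?a = "subst_var Y" and ?b = "subst_var X"
  have a: "?a = var Y + ?b - var X" using subst_var_diff by (simp add: algebra_simps)
  have ba: "?b * ?a = ?b - var X + var Y * var X"
    using subst_var_XY by (simp add: algebra_simps)
  have "(1 - d *\<^sub>R ?b) * (1 - c *\<^sub>R ?a) = 1 - d *\<^sub>R ?b - c *\<^sub>R ?a + (c * d) *\<^sub>R (?b * ?a)"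
    by (simp add: left_diff_distrib right_diff_distrib scaleR_diff_right mult.commute)
  also have "\<dots> = 1 - d *\<^sub>R ?b - c *\<^sub>R (var Y + ?b - var X) + (c + d) *\<^sub>R (?b - var X + var Y * var X)"
    by (simp only: ba a[symmetric] assms)
  also have "\<dots> = 1 - c *\<^sub>R var Y - d *\<^sub>R var X + (c + d) *\<^sub>R (var Y * var X)"
    by (simp add: scaleR_add_left scaleR_add_right scaleR_diff_right)
  also have "\<dots> = (1 - c *\<^sub>R var Y) * (1 - d *\<^sub>R var X)"
    by (simp add: assms left_diff_distrib right_diff_distrib scaleR_diff_right)
  finally have eq: "(1 - d *\<^sub>R ?b) * (1 - c *\<^sub>R ?a) = (1 - c *\<^sub>R var Y) * (1 - d *\<^sub>R var X)" .
  have "(geo (d *\<^sub>R var X) * geo (c *\<^sub>R var Y)) * ((1 - c *\<^sub>R var Y) * (1 - d *\<^sub>R var X))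
      = geo (d *\<^sub>R var X) * (geo (c *\<^sub>R var Y) * (1 - c *\<^sub>R var Y)) * (1 - d *\<^sub>R var X)"
    by (simp only: mult.assoc)
  then have L: "(geo (d *\<^sub>R var X) * geo (c *\<^sub>R var Y)) * ((1 - c *\<^sub>R var Y) * (1 - d *\<^sub>R var X)) = 1"
    by (simp add: geo_left[OF vanish_scaleR[OF vanish_var]])
  have "((1 - d *\<^sub>R ?b) * (1 - c *\<^sub>R ?a)) * (geo (c *\<^sub>R ?a) * geo (d *\<^sub>R ?b))
      = (1 - d *\<^sub>R ?b) * ((1 - c *\<^sub>R ?a) * geo (c *\<^sub>R ?a)) * geo (d *\<^sub>R ?b)"
    by (simp only: mult.assoc)
  then have R: "((1 - d *\<^sub>R ?b) * (1 - c *\<^sub>R ?a)) * (geo (c *\<^sub>R ?a) * geo (d *\<^sub>R ?b)) = 1"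
    by (simp add: geo_right[OF vanish_scaleR[OF vanish_subst_var]])
  show ?thesis
    using inverse_unique_ring[OF L R[unfolded eq]] by simp
qed

section \<open>The modified multiple harmonic sums\<close>

text \<open>The ordered product of the pairs \<open>f (N - j) * g j\<close> for
  \<open>j = 1, \<dots>, k\<close>; in \<open>alt_swap\<close> each pair is reversed.\<close>

primrec alt :: "(nat \<Rightarrow> 'a::monoid_mult) \<Rightarrow> (nat \<Rightarrow> 'a) \<Rightarrow> nat \<Rightarrow> nat \<Rightarrow> 'a" where
  "alt f g N 0 = 1"
| "alt f g N (Suc k) = alt f g N k * (f (N - Suc k) * g (Suc k))"

primrec alt_swap :: "(nat \<Rightarrow> 'a::monoid_mult) \<Rightarrow> (nat \<Rightarrow> 'a) \<Rightarrow> nat \<Rightarrow> nat \<Rightarrow> 'a" where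
  "alt_swap f g N 0 = 1"
| "alt_swap f g N (Suc k) = alt_swap f g N k * (g (Suc k) * f (N - Suc k))"

text \<open>Both sides are the same alternating product; only the pairing of neighbouring factors is
  moved by one place.\<close>

lemma alt_shift: "alt f g (Suc N) k * f (N - k) = f N * alt_swap f g N k"
proof (induction k)
  case (Suc k)
  have "alt f g (Suc N) (Suc k) * f (N - Suc k)
      = (alt f g (Suc N) k * f (N - k)) * (g (Suc k) * f (N - Suc k))"
    by (simp add: mult.assoc)
  then show ?case unfolding Suc.IH by (simp add: mult.assoc)
qed simp

lemma alt_Suc_diag:
  "alt f g (Suc (Suc M)) (Suc M) = f (Suc M) * alt_swap f g (Suc M) M * g (Suc M)"
  using alt_shift[of f g "Suc M" M] by (simp add: mult.assoc[symmetric])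

text \<open>Multiplies both letters by \<open>t\<close>. For \<open>t = N\<close> the parameters
  \<open>1/m\<close>, \<open>1/n\<close> become \<open>c = N/m\<close>, \<open>d = N/n\<close>, and
  \<open>m + n = N\<close> turns into the condition \<open>c + d = c * d\<close> of
  \<open>geo_swap\<close>.\<close>

definition scale :: "real \<Rightarrow> ncs \<Rightarrow> ncs" where
  "scale t f = Abs_ncs (\<lambda>w. t ^ length w * cf f w)"

lemma cf_scale [simp]: "cf (scale t f) w = t ^ length w * cf f w"
  by (simp add: scale_def)

lemma scale_1 [simp]: "scale t 1 = 1"
  by (rule ncs_eqI) simp

lemma scale_mult: "scale t (f * g) = scale t f * scale t g"
proof (rule ncs_eqI)
  fix w :: "letter list"
  have "t ^ length w = t ^ length (take i w) * t ^ length (drop i w)" for i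
    unfolding power_add[symmetric] by (rule arg_cong[where f = "\<lambda>n. t ^ n"]) simp
  then show "cf (scale t (f * g)) w = cf (scale t f * scale t g) w"
    unfolding cf_scale cf_mult sum_distrib_left
    by (intro sum.cong) (simp_all only: mult_ac)
qed

lemma scale_geo_var: "scale t (geo (c *\<^sub>R var l)) = geo ((t * c) *\<^sub>R var l)"
proof -
  have "scale t ((c *\<^sub>R var l) ^ k) = ((t * c) *\<^sub>R var l) ^ k" for k
  proof (induction k)
    case (Suc k)
    have "scale t (c *\<^sub>R var l) = (t * c) *\<^sub>R var l"
      by (rule ncs_eqI) simp
    with Suc show ?case unfolding power_Suc scale_mult by simp
  qed simp
  then have "t ^ length w * cf ((c *\<^sub>R var l) ^ k) w = cf (((t * c) *\<^sub>R var l) ^ k) w" for k w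
    by (metis cf_scale)
  then show ?thesis
    unfolding geo_def scale_def cf_Abs sum_distrib_left by simp
qed

lemma scale_alt: "scale t (alt f g N k) = alt (\<lambda>n. scale t (f n)) (\<lambda>n. scale t (g n)) N k"
  by (induction k) (simp_all add: scale_mult)

definition geoY :: "nat \<Rightarrow> ncs" where "geoY m = geo ((1 / real m) *\<^sub>R var Y)"
definition geoX :: "nat \<Rightarrow> ncs" where "geoX n = geo ((1 / real n) *\<^sub>R var X)"

text \<open>Index shift: \<open>Q_series M\<close> and, below, \<open>P_series M\<close> are the products for \<open>N = M + 1\<close>.\<close>

definition Q_series :: "nat \<Rightarrow> ncs" where "Q_series M = alt geoY geoX (Suc M) M"

text \<open>The two indices within a pair add up to \<open>Suc M\<close>, so \<open>geo_swap\<close>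
  reverses the pairs one after another.\<close>

lemma subst_series_alt:
  assumes "k \<le> M"
  shows "subst_series (alt (\<lambda>m. geo ((real (Suc M) / real m) *\<^sub>R var Y)) (\<lambda>n. geo ((real (Suc M) / real n) *\<^sub>R var X)) (Suc M) k)
    = alt_swap (\<lambda>m. geo ((real (Suc M) / real m) *\<^sub>R var Y)) (\<lambda>n. geo ((real (Suc M) / real n) *\<^sub>R var X)) (Suc M) k"
  using assms
proof (induction k)
  case (Suc k)
  have [simp]: "Suc M - Suc k = M - k" by simp
  have "M - k > 0" using Suc.prems by simp
  then have "real (Suc M) / real (M - k) + real (Suc M) / real (Suc k)
      = real (Suc M) / real (M - k) * (real (Suc M) / real (Suc k))"
    using Suc.prems by (simp add: field_simps of_nat_diff)
  note swap = geo_swap[OF this]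
  show ?case
    using Suc by (simp only: alt.simps alt_swap.simps mult.assoc[symmetric] subst_series_mult_geo)
      (simp only: mult.assoc swap Suc_leD diff_Suc_Suc)
qed (simp add: subst_series_1)

text \<open>By \<open>alt_Suc_diag\<close> the new product is the reversed old one between the
  factors at \<open>Suc M\<close>. Scaling by \<open>Suc M\<close> gives these parameter 1, and
  reversal becomes substitution.\<close>

lemma scale_Q_Suc:
  "scale (real (Suc M)) (Q_series (Suc M)) = geo (var Y) * subst_series (scale (real (Suc M)) (Q_series M)) * geo (var X)"
  unfolding Q_series_def scale_alt geoY_def geoX_def scale_geo_var
  unfolding alt_Suc_diag
  using subst_series_alt[of M M] by simp

section \<open>Transition coefficients from one level to the next\<close>

definition tr_coef :: "letter list \<Rightarrow> letter list \<Rightarrow> real" where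
  "tr_coef w u = cf (geo (var Y) * subst_word u * geo (var X)) w"

text \<open>The coefficients \<open>tr_coef\<close> do not depend on \<open>M\<close>; the level
  enters only through the scaling powers.\<close>

lemma Q_Suc_tr_coef:
  "real (Suc M) ^ length w * cf (Q_series (Suc M)) w =
     (\<Sum>u | length u \<le> length w. tr_coef w u * (real (Suc M) ^ length u * cf (Q_series M) u))"
  unfolding cf_scale[symmetric] scale_Q_Suc
  by (subst cf_mult_subst_mult[OF order_refl]) (simp add: tr_coef_def mult.commute)

definition adm :: "letter list \<Rightarrow> bool" where
  "adm w \<longleftrightarrow> w \<noteq> [] \<and> hd w = Y \<and> last w = X"

text \<open>Multiply \<open>subst_var_XY\<close> by the inverses of \<open>1 - var Y\<close> and
  \<open>1 - subst_var Y\<close>. The outer factor thus turns a leading substituted \<open>X\<close>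
  into a genuine one.\<close>

lemma geo_subst_var_X: "geo (var Y) * subst_var X = var X * geo (subst_var Y)"
proof -
  have "geo (var Y) * (subst_var X * (1 - subst_var Y)) * geo (subst_var Y)
      = (geo (var Y) * (1 - var Y)) * var X * geo (subst_var Y)"
    unfolding subst_var_XY by (simp only: mult.assoc)
  then show ?thesis
    by (simp add: mult.assoc geo_right[OF vanish_subst_var])
      (simp add: mult.assoc[symmetric] geo_left[OF vanish_var])
qed

lemma subst_var_Y_geo: "subst_var Y * geo (var X) = geo (subst_var X) * var Y"
proof -
  have "geo (subst_var X) * ((1 - subst_var X) * subst_var Y) * geo (var X)
      = geo (subst_var X) * var Y * ((1 - var X) * geo (var X))"
    unfolding subst_var_YX by (simp only: mult.assoc)
  then show ?thesis
    by (simp add: mult.assoc[symmetric] geo_left[OF vanish_subst_var])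
      (simp add: mult.assoc geo_right[OF vanish_var])
qed

text \<open>If \<open>u\<close> starts with \<open>X\<close>, the transported series has a left
  factor \<open>X\<close>; if \<open>u\<close> ends with \<open>Y\<close>, it has a right factor
  \<open>Y\<close>. Neither reaches a word \<open>Y \<dots> X\<close>, so the recursion closes on
  admissible words and the empty word.\<close>

lemma tr_coef_nonadm:
  assumes "adm w" "u \<noteq> []" "\<not> adm u"
  shows "tr_coef w u = 0"
proof -
  consider v where "u = X # v" | v where "u = v @ [Y]"
    using assms(2,3) unfolding adm_def
    by (metis (full_types) append_butlast_last_id letter.exhaust list.collapse)
  then show ?thesis
  proof cases
    case 1
    have "geo (var Y) * subst_word u * geo (var X) = (geo (var Y) * subst_var X) * subst_word v * geo (var X)"
      by (simp add: 1 subst_word_def mult.assoc)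
    then have "geo (var Y) * subst_word u * geo (var X) = var X * (geo (subst_var Y) * subst_word v * geo (var X))"
      unfolding geo_subst_var_X by (simp only: mult.assoc)
    moreover obtain w' where "w = Y # w'" using assms(1) by (metis adm_def list.collapse)
    ultimately show ?thesis by (simp add: tr_coef_def)
  next
    case 2
    have "geo (var Y) * subst_word u * geo (var X) = geo (var Y) * subst_word v * (subst_var Y * geo (var X))"
      by (simp add: 2 subst_word_def mult.assoc)
    then have "geo (var Y) * subst_word u * geo (var X) = (geo (var Y) * subst_word v * geo (subst_var X)) * var Y"
      unfolding subst_var_Y_geo by (simp only: mult.assoc)
    moreover obtain w' where "w = w' @ [X]" using assms(1) by (metis adm_def append_butlast_last_id)
    ultimately show ?thesis by (simp add: tr_coef_def)
  qed
qed

lemma geo_var_expand: "vanish 2 (geo (var l) - 1 - var l)"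
proof -
  have 1: "geo (var l) = 1 + var l * geo (var l)"
    using geo_right[OF vanish_var, of l] by (simp add: algebra_simps)
  have "var l * geo (var l) - var l = var l * (1 + var l * geo (var l)) - var l"
    using 1 by (rule arg_cong)
  then have "var l * geo (var l) - var l = var l * (var l * geo (var l))"
    by (simp add: distrib_left)
  moreover have "geo (var l) - 1 = var l * geo (var l)"
    using 1 by (metis add_diff_cancel_left')
  ultimately have "geo (var l) - 1 - var l = var l * (var l * geo (var l))" by (simp only:)
  then show ?thesis
    using vanish_mult[OF vanish_var vanish_mult[OF vanish_var vanish_0(1)], of l l "geo (var l)"]
    by (simp add: numeral_2_eq_2)
qed

text \<open>
  To first order the substitution is the inner derivation by \<open>X - Y\<close>; together with the outer
  factors only \<open>u \<mapsto> X u + u Y\<close> is left, which is invisible in words \<open>Y \<dots> X\<close>. Hence no entry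
  \<open>1\<close> ever appears.
\<close>

lemma tr_coef_expand:
  "vanish (length u + 2) (geo (var Y) * subst_word u * geo (var X) - (word u + var X * word u + word u * var Y))"
proof -
  define z where "z = var X - var Y"
  define W where "W = word u"
  define C where "C = z * W - W * z"
  define S where "S = subst_word u"
  define R where "R = S - W - C"
  define R1 where "R1 = geo (var Y) - 1 - var Y"
  define R2 where "R2 = geo (var X) - 1 - var X"
  define r where "r = R + (var Y * C + (var Y * R + R1 * S))"
  have R: "vanish (length u + 2) R"
    using subst_word_expand[of u] by (simp add: R_def z_def W_def C_def S_def)
  have W: "vanish (length u) W" and S: "vanish (length u) S"
    by (simp_all add: W_def S_def vanish_word vanish_subst_word)
  have R12: "vanish 2 R1" "vanish 2 R2" by (simp_all add: R1_def R2_def geo_var_expand)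
  have z: "vanish 1 z" unfolding z_def by (intro vanish_diff vanish_var)
  have C: "vanish (length u + 1) C"
    using vanish_mult[OF z W] vanish_mult[OF W z]
    unfolding C_def by (intro vanish_diff) simp_all
  have r: "vanish (length u + 2) r"
    unfolding r_def using R vanish_mult[OF vanish_var C, of Y] vanish_mult[OF vanish_var R, of Y]
      vanish_mult[OF R12(1) S] by (intro vanish_add) (auto elim: vanish_mono)
  have CW: "vanish (length u + 1) (C + var Y * W)"
    using C vanish_mult[OF vanish_var W] by (intro vanish_add) simp_all
  have "vanish (length u + 2) (r * geo (var X) + ((C + var Y * W) * var X + (W + (C + var Y * W)) * R2))"
    using vanish_mult[OF r vanish_0(1), of "geo (var X)"] vanish_mult[OF CW vanish_var, of X]
      vanish_mult[OF vanish_add[OF W vanish_mono[OF CW]] R12(2)]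
    by (intro vanish_add) (auto elim: vanish_mono)
  moreover have "geo (var Y) * S * geo (var X) - (W + var X * W + W * var Y)
      = r * geo (var X) + ((C + var Y * W) * var X + (W + (C + var Y * W)) * R2)"
  proof -
    have "geo (var Y) * S = (1 + var Y) * (W + C + R) + R1 * S"
      by (simp add: R1_def R_def algebra_simps)
    then have 1: "geo (var Y) * S = W + (C + var Y * W) + r"
      by (simp add: r_def algebra_simps)
    have "(W + (C + var Y * W)) * geo (var X) = (W + (C + var Y * W)) * (1 + var X + R2)"
      by (simp add: R2_def)
    then show ?thesis
      unfolding 1 by (simp add: distrib_right[of _ r] C_def z_def algebra_simps)
  qed
  ultimately show ?thesis by (simp add: S_def W_def)
qed

text \<open>Up to length \<open>length u + 1\<close> only \<open>u\<close>, \<open>X u\<close> and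
  \<open>u Y\<close> occur, and of these only \<open>u\<close> itself can be a word
  \<open>Y \<dots> X\<close>.\<close>

lemma tr_coef_top:
  assumes "adm w" "length w \<le> Suc (length u)"
  shows "tr_coef w u = (if u = w then 1 else 0)"
proof -
  obtain w' w'' where "w = Y # w'" "w = w'' @ [X]"
    using assms(1) by (metis adm_def append_butlast_last_id list.collapse)
  then have "cf (var X * word u) w = 0" "cf (word u * var Y) w = 0"
    by (metis cf_var_mult_Cons letter.distinct(1), metis cf_mult_var_snoc letter.distinct(1))
  then show ?thesis
    using assms tr_coef_expand[of u] by (auto simp: vanish_def tr_coef_def cf_word)
qed

section \<open>Integrality of the transition coefficients\<close>

definition int_series :: "ncs \<Rightarrow> bool" where
  "int_series f \<longleftrightarrow> (\<forall>w. cf f w \<in> \<int>)"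

lemma int_series_intros:
  "int_series 1" "int_series (var l)"
  "int_series f \<Longrightarrow> int_series g \<Longrightarrow> int_series (f - g)"
  "int_series f \<Longrightarrow> int_series g \<Longrightarrow> int_series (f * g)"
  by (auto simp: int_series_def cf_mult intro!: Ints_sum)

lemma int_series_power: "int_series f \<Longrightarrow> int_series (f ^ k)"
  by (induction k) (auto intro: int_series_intros)

lemma int_series_geo: "int_series h \<Longrightarrow> int_series (geo h)"
  using int_series_power by (auto simp: int_series_def geo_def intro!: Ints_sum)

lemma int_series_binom_series: "int_series binom_series"
proof -
  have "binom_coef w \<in> \<int>" for w
    by (induction w rule: binom_coef.induct) (subst binom_coef.simps, auto)
  then show ?thesis by (simp add: int_series_def binom_series_def)
qed

lemma int_series_subst_word: "int_series (subst_word u)"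
proof (induction u)
  case (Cons l u)
  have "int_series binom_inverse" unfolding binom_inverse_def
    by (intro int_series_geo int_series_intros int_series_binom_series)
  then have "int_series (subst_var l)"
    by (cases l) (auto simp: subst_var_def intro: int_series_intros int_series_binom_series)
  with Cons show ?case by (simp add: subst_word_def int_series_intros)
qed (simp add: subst_word_def int_series_intros)

lemma tr_coef_Ints: "tr_coef w u \<in> \<int>"
  using int_series_intros(4)[OF int_series_intros(4)[OF int_series_geo[OF int_series_intros(2)]
      int_series_subst_word] int_series_geo[OF int_series_intros(2)], of Y u X]
  by (simp add: int_series_def tr_coef_def)

text \<open>Dividing by the power of \<open>Suc M\<close> belonging to \<open>w\<close> leaves
  \<open>u\<close> with \<open>1 / Suc M\<close> to the power \<open>length w - length u\<close>. By
  \<open>tr_coef_top\<close> the words of length at least \<open>length w - 1\<close> contribute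
  only \<open>w\<close> itself, so all these exponents are at least 2.\<close>

lemma Q_Suc:
  assumes "adm w"
  shows "cf (Q_series (Suc M)) w = cf (Q_series M) w +
    (\<Sum>u | length u + 2 \<le> length w \<and> (u = [] \<or> adm u).
       tr_coef w u * (cf (Q_series M) u / real (Suc M) ^ (length w - length u)))"
proof -
  define n where "n = real (Suc M)"
  have n: "n > 0" by (simp add: n_def)
  let ?U = "{u. length u + 2 \<le> length w \<and> (u = [] \<or> adm u)}"
  let ?t = "\<lambda>u. tr_coef w u * (n ^ length u * cf (Q_series M) u)"
  have "n ^ length w * cf (Q_series (Suc M)) w = (\<Sum>u | length u \<le> length w. ?t u)"
    using Q_Suc_tr_coef n_def by simp
  also have "\<dots> = (\<Sum>u\<in>insert w ?U. ?t u)"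
  proof (rule sum.mono_neutral_right)
    show "\<forall>u\<in>{u. length u \<le> length w} - insert w ?U. ?t u = 0"
    proof
      fix u assume u: "u \<in> {u. length u \<le> length w} - insert w ?U"
      show "?t u = 0"
      proof (cases "u = [] \<or> adm u")
        case True
        then show ?thesis using u tr_coef_top[OF assms, of u] by auto
      next
        case False
        then show ?thesis using tr_coef_nonadm[OF assms, of u] by auto
      qed
    qed
  qed auto
  also have "\<dots> = n ^ length w * cf (Q_series M) w + (\<Sum>u\<in>?U. ?t u)"
    by (subst sum.insert) (auto intro: finite_subset[OF _ finite_words[of "length w"]]
        simp: tr_coef_top[OF assms])
  finally have "cf (Q_series (Suc M)) w = cf (Q_series M) w + (\<Sum>u\<in>?U. ?t u) / n ^ length w"
    using n by (simp add: field_simps)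
  also have "(\<Sum>u\<in>?U. ?t u) / n ^ length w
      = (\<Sum>u\<in>?U. tr_coef w u * (cf (Q_series M) u / n ^ (length w - length u)))"
    unfolding sum_divide_distrib using n
    by (intro sum.cong) (auto simp: power_diff)
  finally show ?thesis by (simp add: n_def)
qed

section \<open>Discretised multiple harmonic sums\<close>

definition linY :: "nat \<Rightarrow> ncs" where "linY m = 1 + (1 / real m) *\<^sub>R var Y"

definition P_series :: "nat \<Rightarrow> ncs" where "P_series M = alt linY geoX (Suc M) M"

lemma cf_mult_geo_var_snoc:
  "cf (f * geo (c *\<^sub>R var l)) (w @ [l']) =
     cf f (w @ [l']) + (if l' = l then c * cf (f * geo (c *\<^sub>R var l)) w else 0)"
proof -
  have "geo (c *\<^sub>R var l) = 1 + geo (c *\<^sub>R var l) * (c *\<^sub>R var l)"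
    using geo_left[OF vanish_scaleR[OF vanish_var, of c l]] by (simp add: algebra_simps)
  then have "f * geo (c *\<^sub>R var l) = f * (1 + geo (c *\<^sub>R var l) * (c *\<^sub>R var l))"
    by (rule arg_cong)
  also have "\<dots> = f + c *\<^sub>R (f * geo (c *\<^sub>R var l) * var l)"
    by (simp add: distrib_left mult.assoc)
  finally have "cf (f * geo (c *\<^sub>R var l)) (w @ [l']) =
      cf (f + c *\<^sub>R (f * geo (c *\<^sub>R var l) * var l)) (w @ [l'])"
    by (rule arg_cong)
  then show ?thesis by simp
qed

lemma cf_geo_Nil [simp]: "cf (geo h) [] = 1"
  by (simp add: geo_def)

text \<open>
  With \<open>p = 1 - X/n\<close>, \<open>q = 1 + Y/m\<close> and \<open>m + n = N\<close>, the element \<open>N - X + Y = m q + n p\<close> does not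
  depend on \<open>m\<close> and \<open>n\<close>, and conjugation by it exchanges \<open>p\<^sup>-\<^sup>1 q\<close> and \<open>q p\<^sup>-\<^sup>1\<close>.
\<close>

lemma P_Suc:
  obtains G where
    "P_series (Suc M) = P_series M + (1 / real (Suc M)) *\<^sub>R (P_series M * var Y * geoX (Suc M)) + var X * G"
proof -
  define N where "N = real (Suc M)"
  have N: "N > 0" by (simp add: N_def)
  define z where "z = var X - var Y"
  \<comment> \<open>This is the invariant element \<open>N - X + Y\<close>, normalised to constant
    term 1 so that it is invertible.\<close>
  define T where "T = 1 - (1 / N) *\<^sub>R z"
  have vz: "vanish 1 ((1 / N) *\<^sub>R z)"
    unfolding z_def by (intro vanish_scaleR vanish_diff vanish_var)
  have comm: "T * (geoX n * linY m) = (linY m * geoX n) * T"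
    if mn: "n > 0" "m > 0" "real n + real m = N" for n m
  proof -
    define p where "p = 1 - (1 / real n) *\<^sub>R var X"
    have p: "p * geoX n = 1" "geoX n * p = 1"
      unfolding p_def geoX_def
      by (simp_all add: geo_right[OF vanish_scaleR[OF vanish_var]] geo_left[OF vanish_scaleR[OF vanish_var]])
    have NT: "N *\<^sub>R T = real m *\<^sub>R linY m + real n *\<^sub>R p"
      using mn N by (simp add: T_def z_def linY_def p_def scaleR_diff_right scaleR_add_right
          scaleR_add_left[symmetric])
    have "N *\<^sub>R (T * (geoX n * linY m)) = (N *\<^sub>R T) * (geoX n * linY m)" by simp
    also have "\<dots> = real m *\<^sub>R (linY m * (geoX n * linY m)) + real n *\<^sub>R ((p * geoX n) * linY m)"
      unfolding NT by (simp add: distrib_right mult.assoc)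
    also have "\<dots> = (linY m * geoX n) * (N *\<^sub>R T)"
      unfolding NT using p by (simp add: distrib_left mult.assoc)
    finally show ?thesis using N by simp
  qed
  \<comment> \<open>\<open>T\<close> is carried through the product pair by pair, each time undoing
    one reversal.\<close>
  have "T * alt_swap linY geoX (Suc M) k = alt linY geoX (Suc M) k * T" if "k \<le> M" for k
    using that
  proof (induction k)
    case (Suc k)
    have "real (Suc k) + real (Suc M - Suc k) = N" "Suc M - Suc k > 0"
      using Suc.prems by (auto simp: N_def of_nat_diff)
    note c = comm[OF _ this(2,1)]
    have "T * alt_swap linY geoX (Suc M) (Suc k)
        = (T * alt_swap linY geoX (Suc M) k) * (geoX (Suc k) * linY (Suc M - Suc k))"
      by (simp add: mult.assoc)
    also have "\<dots> = alt linY geoX (Suc M) k * (T * (geoX (Suc k) * linY (Suc M - Suc k)))"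
      using Suc by (simp add: mult.assoc)
    also have "\<dots> = alt linY geoX (Suc M) (Suc k) * T"
      unfolding c[OF zero_less_Suc] by (simp add: mult.assoc)
    finally show ?case .
  qed simp
  then have TA: "T * alt_swap linY geoX (Suc M) M = P_series M * T"
    by (simp add: P_series_def)
  define V where "V = geo ((1 / N) *\<^sub>R z)"
  have V: "V * T = 1" "T * V = 1"
    unfolding V_def T_def by (simp_all only: geo_left[OF vz] geo_right[OF vz])
  have A: "alt_swap linY geoX (Suc M) M = V * P_series M * T"
    using arg_cong[OF TA, of "\<lambda>x. V * x"] V by (simp add: mult.assoc[symmetric])
  \<comment> \<open>The outer factors absorb \<open>V\<close> and \<open>T\<close>. On the left an
    error with left factor \<open>X\<close> remains, collected in \<open>G\<close>; on the right the
    new term with \<open>var Y * geoX (Suc M)\<close> appears.\<close>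
  have "linY (Suc M) = T + (1 / N) *\<^sub>R var X"
    by (simp add: linY_def T_def z_def N_def scaleR_diff_right)
  then have L: "linY (Suc M) * V = 1 + (1 / N) *\<^sub>R (var X * V)"
    by (simp add: distrib_right V)
  have "T = (1 - (1 / N) *\<^sub>R var X) + (1 / N) *\<^sub>R var Y"
    by (simp add: T_def z_def scaleR_diff_right)
  moreover have "(1 - (1 / N) *\<^sub>R var X) * geoX (Suc M) = 1"
    unfolding geoX_def N_def by (rule geo_right[OF vanish_scaleR[OF vanish_var]])
  ultimately have R: "T * geoX (Suc M) = 1 + (1 / N) *\<^sub>R (var Y * geoX (Suc M))"
    by (simp add: distrib_right)
  have "P_series (Suc M) = linY (Suc M) * alt_swap linY geoX (Suc M) M * geoX (Suc M)"
    unfolding P_series_def alt_Suc_diag ..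
  also have "\<dots> = (linY (Suc M) * V) * P_series M * (T * geoX (Suc M))"
    unfolding A by (simp only: mult.assoc)
  also have "\<dots> = P_series M * (T * geoX (Suc M)) + var X * ((1 / N) *\<^sub>R (V * P_series M * (T * geoX (Suc M))))"
    unfolding L by (simp add: distrib_right mult.assoc)
  also have "P_series M * (T * geoX (Suc M)) = P_series M + (1 / N) *\<^sub>R (P_series M * var Y * geoX (Suc M))"
    unfolding R by (simp add: distrib_left mult.assoc)
  finally show ?thesis using that N_def by blast
qed

definition index_word :: "nat list \<Rightarrow> letter list" where
  "index_word ks = concat (map (\<lambda>k. Y # replicate (k - 1) X) ks)"

text \<open>Since \<open>geoX n\<close> contains only powers of \<open>X\<close>, the middle factor
  \<open>var Y\<close> has to be the last \<open>Y\<close> of the word.\<close>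

lemma cf_Y_geoX: "cf (f * var Y * geoX n) (w @ Y # replicate j X) = cf f w / real n ^ j"
proof (induction j)
  case 0
  then show ?case unfolding geoX_def by (simp only: replicate.simps cf_mult_geo_var_snoc) simp
next
  case (Suc j)
  have eq: "w @ Y # replicate (Suc j) X = (w @ Y # replicate j X) @ [X]"
    by (simp add: replicate_append_same)
  show ?case
    unfolding eq using Suc by (simp only: geoX_def cf_mult_geo_var_snoc cf_mult_var_snoc) simp
qed

text \<open>The term with left factor \<open>X\<close> is invisible on words starting with
  \<open>Y\<close>. What remains is the recursion of truncated sums, with last entry
  \<open>Suc j\<close>.\<close>

lemma cf_P_Suc:
  assumes "w \<noteq> [] \<Longrightarrow> hd w = Y"
  shows "cf (P_series (Suc M)) (w @ Y # replicate j X) =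
    cf (P_series M) (w @ Y # replicate j X) + cf (P_series M) w / real (Suc M) ^ Suc j"
proof -
  obtain G where G: "P_series (Suc M) = P_series M + (1 / real (Suc M)) *\<^sub>R (P_series M * var Y * geoX (Suc M)) + var X * G"
    using P_Suc .
  have "cf (var X * G) (w @ Y # replicate j X) = 0"
    using assms by (cases w) auto
  then show ?thesis unfolding G by (simp add: cf_Y_geoX)
qed

section \<open>Truncated multiple zeta values\<close>

definition upto_tuples :: "nat \<Rightarrow> nat \<Rightarrow> nat list set" where
  "upto_tuples M r = {ns. length ns = r \<and> sorted_wrt (<) ns \<and> (\<forall>n\<in>set ns. 0 < n \<and> n \<le> M)}"

definition mhs :: "nat \<Rightarrow> nat list \<Rightarrow> real" where
  "mhs M ks = (\<Sum>ns\<in>upto_tuples M (length ks). \<Prod>i<length ks. 1 / real (ns ! i) ^ (ks ! i))"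

lemma finite_upto_tuples: "finite (upto_tuples M r)"
  by (rule finite_subset[OF _ finite_lists_length_eq[of "{0..M}" r]]) (auto simp: upto_tuples_def)

lemma mhs_Nil [simp]: "mhs M [] = 1"
proof -
  have "upto_tuples M 0 = {[]}" by (auto simp: upto_tuples_def)
  then show ?thesis by (simp add: mhs_def)
qed

lemma mhs_0: "ks \<noteq> [] \<Longrightarrow> mhs 0 ks = 0"
proof -
  assume "ks \<noteq> []"
  then have "ns \<notin> upto_tuples 0 (length ks)" for ns
    by (cases ns) (auto simp: upto_tuples_def)
  then have "upto_tuples 0 (length ks) = {}" by blast
  then show ?thesis by (simp add: mhs_def)
qed

lemma upto_tuples_Suc:
  "upto_tuples (Suc M) (Suc r) = upto_tuples M (Suc r) \<union> (\<lambda>ns. ns @ [Suc M]) ` upto_tuples M r"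
proof (intro equalityI subsetI)
  fix ns assume ns: "ns \<in> upto_tuples (Suc M) (Suc r)"
  then obtain ms m where m: "ns = ms @ [m]"
    by (cases ns rule: rev_cases) (auto simp: upto_tuples_def)
  show "ns \<in> upto_tuples M (Suc r) \<union> (\<lambda>ns. ns @ [Suc M]) ` upto_tuples M r"
  proof (cases "m = Suc M")
    case True
    then have "ms \<in> upto_tuples M r"
      using ns m by (fastforce simp: upto_tuples_def sorted_wrt_append)
    then show ?thesis using True m by blast
  next
    case False
    then have "ns \<in> upto_tuples M (Suc r)"
      using ns m by (fastforce simp: upto_tuples_def sorted_wrt_append)
    then show ?thesis by blast
  qed
qed (fastforce simp: upto_tuples_def sorted_wrt_append)+

lemma mhs_Suc: "mhs (Suc M) (ks @ [k]) = mhs M (ks @ [k]) + mhs M ks / real (Suc M) ^ k"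
proof -
  let ?f = "\<lambda>ns. \<Prod>i<length (ks @ [k]). 1 / real (ns ! i) ^ ((ks @ [k]) ! i)"
  let ?S = "upto_tuples M (length ks)"
  have "mhs (Suc M) (ks @ [k]) = sum ?f (upto_tuples M (Suc (length ks)) \<union> (\<lambda>ns. ns @ [Suc M]) ` ?S)"
    by (simp add: mhs_def upto_tuples_Suc)
  also have "\<dots> = mhs M (ks @ [k]) + sum ?f ((\<lambda>ns. ns @ [Suc M]) ` ?S)"
    by (subst sum.union_disjoint) (simp_all add: finite_upto_tuples mhs_def, auto simp: upto_tuples_def)
  also have "sum ?f ((\<lambda>ns. ns @ [Suc M]) ` ?S) = (\<Sum>ns\<in>?S. ?f (ns @ [Suc M]))"
    by (rule sum.reindex_cong[where l = "\<lambda>ns. ns @ [Suc M]"]) (auto simp: inj_on_def)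
  also have "\<dots> = mhs M ks / real (Suc M) ^ k"
    unfolding mhs_def sum_divide_distrib
  proof (rule sum.cong)
    fix ns assume "ns \<in> ?S"
    then have "length ns = length ks" by (simp add: upto_tuples_def)
    then show "?f (ns @ [Suc M]) = (\<Prod>i<length ks. 1 / real (ns ! i) ^ (ks ! i)) / real (Suc M) ^ k"
      by (simp add: nth_append)
  qed simp
  finally show ?thesis .
qed

text \<open>Both sides obey the same recursion in \<open>M\<close> (\<open>cf_P_Suc\<close> and
  \<open>mhs_Suc\<close>) and agree at \<open>M = 0\<close>, where the product is empty.\<close>

lemma P_index_word: "is_index ks \<Longrightarrow> cf (P_series M) (index_word ks) = mhs M ks"
proof (induction M arbitrary: ks)
  case 0
  show ?case
  proof (cases "ks = []")
    case False
    then have "index_word ks \<noteq> []" by (cases ks) (auto simp: index_word_def)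
    then show ?thesis using False by (simp add: P_series_def mhs_0)
  qed (simp add: P_series_def index_word_def)
next
  case (Suc M)
  show ?case
  proof (cases ks rule: rev_cases)
    case Nil
    obtain G where "P_series (Suc M) = P_series M + (1 / real (Suc M)) *\<^sub>R (P_series M * var Y * geoX (Suc M)) + var X * G"
      using P_Suc .
    then show ?thesis
      using Suc.IH[of "[]"] Nil by (simp add: is_index_def index_word_def)
  next
    case (snoc ks' k)
    have k: "Suc (k - 1) = k" and ix: "is_index ks'" using Suc.prems snoc by (auto simp: is_index_def)
    have w: "index_word ks = index_word ks' @ Y # replicate (k - 1) X"
      by (simp add: snoc index_word_def)
    have "index_word ks' \<noteq> [] \<Longrightarrow> hd (index_word ks') = Y"
      by (cases ks') (auto simp: index_word_def)
    from cf_P_Suc[OF this, of M "k - 1"] show ?thesis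
      using Suc.IH[OF Suc.prems] Suc.IH[OF ix] unfolding w[symmetric] k
      by (simp add: mhs_Suc snoc)
  qed
qed

section \<open>Comparison of the two discretisations\<close>

text \<open>Partial products after \<open>k\<close> pairs; \<open>R_part\<close> includes also the
  \<open>Y\<close>-factor of the next pair. For \<open>k \<ge> M\<close> that factor is 1, since
  division by 0 gives 0.\<close>

definition Q_part :: "nat \<Rightarrow> nat \<Rightarrow> ncs" where "Q_part M = alt geoY geoX (Suc M)"
definition P_part :: "nat \<Rightarrow> nat \<Rightarrow> ncs" where "P_part M = alt linY geoX (Suc M)"
definition R_part :: "nat \<Rightarrow> nat \<Rightarrow> ncs" where "R_part M k = Q_part M k * geoY (M - k)"

lemma Q_part_0 [simp]: "Q_part M 0 = 1" and P_part_0 [simp]: "P_part M 0 = 1"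
  by (simp_all add: Q_part_def P_part_def)

lemma Q_part_Nil [simp]: "cf (Q_part M k) [] = 1" and R_part_Nil [simp]: "cf (R_part M k) [] = 1"
  and P_part_Nil [simp]: "cf (P_part M k) [] = 1"
proof -
  show 1: "cf (Q_part M k) [] = 1"
    by (induction k) (simp_all add: Q_part_def geoX_def geoY_def)
  then show "cf (R_part M k) [] = 1" by (simp add: R_part_def geoY_def)
  show "cf (P_part M k) [] = 1"
    by (induction k) (simp_all add: P_part_def geoX_def linY_def)
qed

lemma Q_part_Suc: "Q_part M (Suc k) = R_part M k * geoX (Suc k)"
  and P_part_Suc: "P_part M (Suc k) = P_part M k * linY (M - k) * geoX (Suc k)"
  by (simp_all add: Q_part_def R_part_def P_part_def mult.assoc)

lemma R_part_snoc:
  "cf (R_part M k) (w @ [X]) = cf (Q_part M k) (w @ [X])"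
  "cf (R_part M k) (w @ [Y]) = cf (Q_part M k) (w @ [Y]) + cf (R_part M k) w / real (M - k)"
  by (simp_all add: R_part_def geoY_def cf_mult_geo_var_snoc)

lemma Q_part_snoc_X: "cf (Q_part M k) (w @ [X]) = (\<Sum>i<k. cf (Q_part M (Suc i)) w / real (Suc i))"
proof (induction k)
  case (Suc k)
  have "cf (Q_part M (Suc k)) (w @ [X]) = cf (Q_part M k) (w @ [X]) + cf (Q_part M (Suc k)) w / real (Suc k)"
    by (simp add: Q_part_Suc geoX_def cf_mult_geo_var_snoc R_part_snoc)
  then show ?case using Suc by simp
qed simp

lemma Q_part_snoc_Y: "cf (Q_part M k) (w @ [Y]) = (\<Sum>i<k. cf (R_part M i) w / real (M - i))"
proof (induction k)
  case (Suc k)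
  have "cf (Q_part M (Suc k)) (w @ [Y]) = cf (Q_part M k) (w @ [Y]) + cf (R_part M k) w / real (M - k)"
    by (simp add: Q_part_Suc geoX_def cf_mult_geo_var_snoc R_part_snoc)
  then show ?case using Suc by simp
qed simp

lemma P_part_snoc_X: "cf (P_part M k) (w @ [X]) = (\<Sum>i<k. cf (P_part M (Suc i)) w / real (Suc i))"
proof (induction k)
  case (Suc k)
  have "cf (P_part M (Suc k)) (w @ [X]) = cf (P_part M k) (w @ [X]) + cf (P_part M (Suc k)) w / real (Suc k)"
    by (simp add: P_part_Suc geoX_def cf_mult_geo_var_snoc) (simp add: linY_def distrib_left)
  then show ?case using Suc by simp
qed simp

lemma P_part_snoc_Y: "cf (P_part M k) (w @ [Y]) = (\<Sum>i<k. cf (P_part M i) w / real (M - i))"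
proof (induction k)
  case (Suc k)
  have "cf (P_part M (Suc k)) (w @ [Y]) = cf (P_part M k) (w @ [Y]) + cf (P_part M k) w / real (M - k)"
    by (simp add: P_part_Suc geoX_def cf_mult_geo_var_snoc) (simp add: linY_def distrib_left)
  then show ?case using Suc by simp
qed simp

lemma letter_rev_induct [case_names Nil X Y]:
  assumes "Pr []" "\<And>w. Pr w \<Longrightarrow> Pr (w @ [X])" "\<And>w. Pr w \<Longrightarrow> Pr (w @ [Y])"
  shows "Pr w"
proof (induction w rule: rev_induct)
  case (snoc l w)
  then show ?case using assms by (cases l) auto
qed (rule assms)

lemma Q_part_Rk_nonneg: "0 \<le> cf (Q_part M k) w \<and> 0 \<le> cf (R_part M k) w"
proof (induction w arbitrary: k rule: letter_rev_induct)
  case (X w)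
  have "0 \<le> cf (Q_part M k) (w @ [X])" for k
    unfolding Q_part_snoc_X using X by (intro sum_nonneg divide_nonneg_nonneg) auto
  then show ?case by (simp add: R_part_snoc)
next
  case (Y w)
  have "0 \<le> cf (Q_part M k) (w @ [Y])" for k
    unfolding Q_part_snoc_Y using Y by (intro sum_nonneg divide_nonneg_nonneg) auto
  then show ?case using Y by (auto simp: R_part_snoc)
qed simp

lemma R_part_le_Qk: "cf (R_part M k) w \<le> cf (Q_part M (Suc k)) w"
proof (cases w rule: rev_cases)
  case (snoc v l)
  then show ?thesis
    using Q_part_Rk_nonneg[of M "Suc k" v] by (cases l) (simp_all add: R_part_snoc Q_part_snoc_X Q_part_snoc_Y)
qed simp

lemma harm_as_sums:
  shows "(\<Sum>i<M. 1 / real (Suc i)) = harm M" "(\<Sum>i<M. 1 / real (M - i)) = harm M"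
proof -
  show 1: "(\<Sum>i<M. 1 / real (Suc i)) = harm M"
    by (simp add: harm_altdef inverse_eq_divide)
  have "(\<Sum>i<M. 1 / real (M - i)) = (\<Sum>i<M. 1 / real (Suc (M - Suc i)))"
    by (intro sum.cong) (auto simp: Suc_diff_Suc)
  also have "\<dots> = harm M"
    using 1 sum.nat_diff_reindex[of "\<lambda>i. 1 / real (Suc i)" M] by simp
  finally show "(\<Sum>i<M. 1 / real (M - i)) = harm M" .
qed

lemma weighted_sum_le:
  fixes f c :: "nat \<Rightarrow> real"
  assumes "k \<le> M" "\<And>i. i < k \<Longrightarrow> f i \<le> B" "0 \<le> B" "\<And>i. 0 \<le> c i"
  shows "(\<Sum>i<k. f i * c i) \<le> B * (\<Sum>i<M. c i)"
proof -
  have "(\<Sum>i<k. f i * c i) \<le> (\<Sum>i<k. B * c i)"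
    using assms by (intro sum_mono mult_right_mono) auto
  also have "\<dots> \<le> (\<Sum>i<M. B * c i)"
    using assms by (intro sum_mono2) auto
  finally show ?thesis by (simp add: sum_distrib_left)
qed

text \<open>Each letter costs one summation with weights \<open>1 / Suc i\<close> or
  \<open>1 / (M - i)\<close>, hence at most one harmonic number.\<close>

lemma Q_part_le:
  assumes "harm M \<le> h" "k \<le> M"
  shows "cf (Q_part M k) w \<le> h ^ length w"
  using assms(2)
proof (induction w arbitrary: k rule: letter_rev_induct)
  case (X w)
  have h: "0 \<le> h" using assms(1) harm_nonneg[of M, where ?'a = real] by simp
  have "cf (Q_part M k) (w @ [X]) = (\<Sum>i<k. cf (Q_part M (Suc i)) w * (1 / real (Suc i)))"
    by (simp add: Q_part_snoc_X)
  also have "\<dots> \<le> h ^ length w * (\<Sum>i<M. 1 / real (Suc i))"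
    using X h by (intro weighted_sum_le) auto
  also have "\<dots> \<le> h ^ length w * h"
    unfolding harm_as_sums using assms(1) h by (intro mult_left_mono) auto
  finally show ?case by (simp add: mult.commute)
next
  case (Y w)
  have h: "0 \<le> h" using assms(1) harm_nonneg[of M, where ?'a = real] by simp
  have "cf (Q_part M k) (w @ [Y]) = (\<Sum>i<k. cf (R_part M i) w * (1 / real (M - i)))"
    by (simp add: Q_part_snoc_Y)
  also have "\<dots> \<le> h ^ length w * (\<Sum>i<M. 1 / real (M - i))"
    using Y h by (intro weighted_sum_le) (auto intro: order_trans[OF R_part_le_Qk])
  also have "\<dots> \<le> h ^ length w * h"
    unfolding harm_as_sums using assms(1) h by (intro mult_left_mono) auto
  finally show ?case by (simp add: mult.commute)
qed simp

text \<open>Measures the accumulated difference between the factors \<open>1 + Y/m\<close> and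
  \<open>(1 - Y/m)^-1\<close>, which agree up to order \<open>1/m\<close>.\<close>

definition inv_sq_sum :: "nat \<Rightarrow> nat \<Rightarrow> real" where
  "inv_sq_sum M k = (\<Sum>i<k. 1 / real (M - i) ^ 2)"

lemma inv_sq_sum_mono: "k \<le> k' \<Longrightarrow> inv_sq_sum M k \<le> inv_sq_sum M k'"
  unfolding inv_sq_sum_def by (intro sum_mono2) auto

lemma inv_sq_sum_nonneg: "0 \<le> inv_sq_sum M k"
  unfolding inv_sq_sum_def by (intro sum_nonneg) auto

lemma R_part_minus_Qk_le:
  assumes "harm M \<le> h" "1 \<le> h" "k < M"
  shows "0 \<le> cf (R_part M k) w - cf (Q_part M k) w" "cf (R_part M k) w - cf (Q_part M k) w \<le> h ^ length w / real (M - k)"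
proof -
  have "0 \<le> cf (R_part M k) w - cf (Q_part M k) w \<and> cf (R_part M k) w - cf (Q_part M k) w \<le> h ^ length w / real (M - k)"
  proof (cases w rule: rev_cases)
    case (snoc v l)
    have "cf (R_part M k) v \<le> h ^ length v"
      using R_part_le_Qk[of M k v] Q_part_le[OF assms(1), of "Suc k" v] assms(3) by simp
    also have "\<dots> \<le> h ^ length w"
      using assms(2) snoc by (intro power_increasing) auto
    finally show ?thesis
      using snoc Q_part_Rk_nonneg[of M k v] assms
      by (cases l) (auto simp: R_part_snoc intro!: divide_right_mono)
  qed (use assms in simp)
  then show "0 \<le> cf (R_part M k) w - cf (Q_part M k) w" "cf (R_part M k) w - cf (Q_part M k) w \<le> h ^ length w / real (M - k)"
    by auto
qed

text \<open>A letter \<open>X\<close> only sums the error of the shorter word. A letter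
  \<open>Y\<close> adds the contribution of repeated \<open>Y\<close> from one factor, at most
  \<open>h ^ length w * inv_sq_sum M k\<close>. Keeping \<open>k\<close> in the bound is what allows
  the later gain for small \<open>k\<close>.\<close>

lemma Q_part_minus_Pk_bounds:
  assumes "harm M \<le> h" "1 \<le> h" "k \<le> M"
  shows "0 \<le> cf (Q_part M k) w - cf (P_part M k) w \<and>
    cf (Q_part M k) w - cf (P_part M k) w \<le> real (length w) * h ^ length w * inv_sq_sum M k"
  using assms(3)
proof (induction w arbitrary: k rule: letter_rev_induct)
  case (X w)
  let ?B = "real (length w) * h ^ length w * inv_sq_sum M k"
  have h: "0 \<le> h" using assms(2) by simp
  have eq: "cf (Q_part M k) (w @ [X]) - cf (P_part M k) (w @ [X])
      = (\<Sum>i<k. (cf (Q_part M (Suc i)) w - cf (P_part M (Suc i)) w) * (1 / real (Suc i)))"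
    by (simp add: Q_part_snoc_X P_part_snoc_X sum_subtractf diff_divide_distrib)
  have le: "cf (Q_part M (Suc i)) w - cf (P_part M (Suc i)) w \<le> ?B" if "i < k" for i
  proof -
    have "cf (Q_part M (Suc i)) w - cf (P_part M (Suc i)) w \<le> real (length w) * h ^ length w * inv_sq_sum M (Suc i)"
      using X.IH[of "Suc i"] X.prems that by simp
    also have "\<dots> \<le> ?B"
      using that h by (intro mult_left_mono inv_sq_sum_mono) auto
    finally show ?thesis .
  qed
  have "0 \<le> cf (Q_part M k) (w @ [X]) - cf (P_part M k) (w @ [X])"
    unfolding eq using X by (intro sum_nonneg mult_nonneg_nonneg) auto
  moreover have "cf (Q_part M k) (w @ [X]) - cf (P_part M k) (w @ [X]) \<le> ?B * (\<Sum>i<M. 1 / real (Suc i))"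
    unfolding eq using X.prems le h by (intro weighted_sum_le) (auto simp: inv_sq_sum_nonneg)
  moreover have "?B * (\<Sum>i<M. 1 / real (Suc i)) \<le> ?B * h"
    unfolding harm_as_sums using assms(1) h by (intro mult_left_mono) (auto simp: inv_sq_sum_nonneg)
  moreover have "?B * h \<le> real (length (w @ [X])) * h ^ length (w @ [X]) * inv_sq_sum M k"
    using h inv_sq_sum_nonneg[of M k] by (simp add: algebra_simps)
  ultimately show ?case by linarith
next
  case (Y w)
  let ?B = "real (length w) * h ^ length w * inv_sq_sum M k"
  have h: "0 \<le> h" using assms(2) by simp
  \<comment> \<open>The difference of \<open>R_part\<close> and \<open>P_part\<close> is split at
    \<open>Q_part\<close>: an inherited error and a new one.\<close>
  have eq: "cf (Q_part M k) (w @ [Y]) - cf (P_part M k) (w @ [Y])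
      = (\<Sum>i<k. (cf (Q_part M i) w - cf (P_part M i) w) * (1 / real (M - i)))
        + (\<Sum>i<k. (cf (R_part M i) w - cf (Q_part M i) w) / real (M - i))"
    by (simp add: Q_part_snoc_Y P_part_snoc_Y sum_subtractf[symmetric] sum.distrib[symmetric] diff_divide_distrib)
  have le: "cf (Q_part M i) w - cf (P_part M i) w \<le> ?B" if "i < k" for i
  proof -
    have "cf (Q_part M i) w - cf (P_part M i) w \<le> real (length w) * h ^ length w * inv_sq_sum M i"
      using Y.IH[of i] Y.prems that by simp
    also have "\<dots> \<le> ?B"
      using that h by (intro mult_left_mono inv_sq_sum_mono) auto
    finally show ?thesis .
  qed
  have "0 \<le> cf (Q_part M k) (w @ [Y]) - cf (P_part M k) (w @ [Y])"
    unfolding eq using Y R_part_minus_Qk_le(1)[OF assms(1,2)]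
    by (intro add_nonneg_nonneg sum_nonneg mult_nonneg_nonneg divide_nonneg_nonneg) auto
  moreover have "(\<Sum>i<k. (cf (Q_part M i) w - cf (P_part M i) w) * (1 / real (M - i))) \<le> ?B * (\<Sum>i<M. 1 / real (M - i))"
    using Y.prems le h by (intro weighted_sum_le) (auto simp: inv_sq_sum_nonneg)
  moreover have "?B * (\<Sum>i<M. 1 / real (M - i)) \<le> ?B * h"
    unfolding harm_as_sums using assms(1) h by (intro mult_left_mono) (auto simp: inv_sq_sum_nonneg)
  moreover have "(\<Sum>i<k. (cf (R_part M i) w - cf (Q_part M i) w) / real (M - i)) \<le> h ^ length w * inv_sq_sum M k"
  proof -
    have "(\<Sum>i<k. (cf (R_part M i) w - cf (Q_part M i) w) / real (M - i))
        \<le> (\<Sum>i<k. (h ^ length w / real (M - i)) / real (M - i))"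
      using Y.prems R_part_minus_Qk_le(2)[OF assms(1,2)]
      by (intro sum_mono divide_right_mono) auto
    also have "\<dots> = h ^ length w * inv_sq_sum M k"
      by (simp add: inv_sq_sum_def sum_distrib_left power2_eq_square)
    finally show ?thesis .
  qed
  moreover have "h ^ length w * inv_sq_sum M k \<le> h * (h ^ length w * inv_sq_sum M k)"
    using mult_right_mono[OF assms(2), of "h ^ length w * inv_sq_sum M k"] h inv_sq_sum_nonneg[of M k]
    by simp
  moreover have "?B * h + h * (h ^ length w * inv_sq_sum M k)
      = real (length (w @ [Y])) * h ^ length (w @ [Y]) * inv_sq_sum M k"
    by (simp add: algebra_simps)
  ultimately show ?case unfolding eq by linarith
qed simp

text \<open>Telescoping with \<open>1/m^2 \<le> 2 * (1/m - 1/(m+1))\<close>. The factor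
  \<open>k\<close> in the result is meant to cancel the weight \<open>1/k\<close> of a final
  \<open>X\<close>.\<close>

lemma inv_sq_sum_le:
  assumes "k \<le> M"
  shows "inv_sq_sum M k \<le> 2 * real k / (real (Suc M) * real (Suc M - k))"
proof -
  have "inv_sq_sum M k \<le> (\<Sum>i<k. 2 * (1 / real (Suc M - Suc i) - 1 / real (Suc M - i)))"
    unfolding inv_sq_sum_def
  proof (rule sum_mono)
    fix i assume "i \<in> {..<k}"
    then obtain m where m: "M - i = Suc m" "Suc M - i = Suc (Suc m)"
      using assms by (metis Suc_diff_Suc Suc_diff_le lessThan_iff less_imp_le order_less_le_trans)
    show "1 / (real (M - i))\<^sup>2 \<le> 2 * (1 / real (Suc M - Suc i) - 1 / real (Suc M - i))"
      unfolding diff_Suc_Suc m by (simp add: divide_simps power2_eq_square)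
  qed
  also have "\<dots> = 2 * (1 / real (Suc M - k) - 1 / real (Suc M))"
    by (induction k) (auto simp: sum_distrib_left[symmetric])
  also have "\<dots> = 2 * real k / (real (Suc M) * real (Suc M - k))"
    using assms by (simp add: field_simps of_nat_diff)
  finally show ?thesis .
qed

text \<open>Here the final \<open>X\<close> matters: its weight \<open>1 / Suc i\<close> cancels the
  numerator in \<open>inv_sq_sum_le\<close>. The remaining sum of \<open>1 / (M - i)\<close> is
  harmonic, and a factor \<open>1 / Suc M\<close> is gained.\<close>

lemma Q_minus_P_le:
  assumes "harm M \<le> h" "1 \<le> h"
  shows "0 \<le> cf (Q_series M) (w @ [X]) - cf (P_series M) (w @ [X])"
    and "cf (Q_series M) (w @ [X]) - cf (P_series M) (w @ [X]) \<le> 2 * real (length w) * h ^ Suc (length w) / real (Suc M)"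
proof -
  have QP_eq: "Q_series M = Q_part M M" "P_series M = P_part M M" by (simp_all add: Q_series_def P_series_def Q_part_def P_part_def)
  show "0 \<le> cf (Q_series M) (w @ [X]) - cf (P_series M) (w @ [X])"
    unfolding QP_eq using Q_part_minus_Pk_bounds[OF assms order_refl] by blast
  let ?C = "real (length w) * h ^ length w"
  have C: "0 \<le> ?C" using assms by simp
  have "cf (Q_series M) (w @ [X]) - cf (P_series M) (w @ [X])
      = (\<Sum>i<M. (cf (Q_part M (Suc i)) w - cf (P_part M (Suc i)) w) / real (Suc i))"
    by (simp add: QP_eq Q_part_snoc_X P_part_snoc_X sum_subtractf diff_divide_distrib)
  also have "\<dots> \<le> (\<Sum>i<M. (2 * ?C / real (Suc M)) * (1 / real (M - i)))"
  proof (rule sum_mono)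
    fix i assume "i \<in> {..<M}"
    then have i: "Suc i \<le> M" by simp
    have "cf (Q_part M (Suc i)) w - cf (P_part M (Suc i)) w \<le> ?C * inv_sq_sum M (Suc i)"
      using Q_part_minus_Pk_bounds[OF assms i] by blast
    also have "\<dots> \<le> ?C * (2 * real (Suc i) / (real (Suc M) * real (Suc M - Suc i)))"
      using C by (intro mult_left_mono inv_sq_sum_le i)
    finally have "(cf (Q_part M (Suc i)) w - cf (P_part M (Suc i)) w) / real (Suc i)
        \<le> ?C * (2 * real (Suc i) / (real (Suc M) * real (Suc M - Suc i))) / real (Suc i)"
      by (intro divide_right_mono) auto
    also have "\<dots> = (2 * ?C / real (Suc M)) * (1 / real (M - i))"
      by (simp add: field_simps del: of_nat_Suc)
    finally show "(cf (Q_part M (Suc i)) w - cf (P_part M (Suc i)) w) / real (Suc i)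
        \<le> (2 * ?C / real (Suc M)) * (1 / real (M - i))" .
  qed
  also have "\<dots> = (2 * ?C / real (Suc M)) * harm M"
    by (simp only: sum_distrib_left[symmetric] harm_as_sums)
  also have "\<dots> \<le> (2 * ?C / real (Suc M)) * h"
    using C assms by (intro mult_left_mono) auto
  finally show "cf (Q_series M) (w @ [X]) - cf (P_series M) (w @ [X]) \<le> 2 * real (length w) * h ^ Suc (length w) / real (Suc M)"
    by (simp add: mult_ac)
qed

lemma harm_le_ln: "harm M \<le> 1 + ln (real (Suc M))"
proof -
  have "harm (Suc M) \<le> 1 + ln (real (Suc M))" for M
  proof (induction M)
    case (Suc M)
    have "ln (real (Suc M) / real (Suc (Suc M))) \<le> real (Suc M) / real (Suc (Suc M)) - 1"
      by (rule ln_le_minus_one) simp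
    also have "\<dots> = - inverse (real (Suc (Suc M)))"
      by (simp add: field_simps)
    finally have "inverse (real (Suc (Suc M))) \<le> ln (real (Suc (Suc M))) - ln (real (Suc M))"
      by (simp add: ln_div)
    then show ?case using Suc by (subst harm_Suc) simp
  qed (simp add: harm_expand)
  from this[of M] show ?thesis
    using harm_mono[of M "Suc M", where ?'a = real] by simp
qed

lemma Q_minus_P_tendsto_0:
  "(\<lambda>M. cf (Q_series M) (w @ [X]) - cf (P_series M) (w @ [X])) \<longlonglongrightarrow> 0"
proof (rule tendsto_sandwich[where f = "\<lambda>_. 0"
      and h = "\<lambda>M. 2 * real (length w) * (1 + ln (real (Suc M))) ^ Suc (length w) / real (Suc M)"])
  \<comment> \<open>With the exponent named, the bound is a fixed power of a logarithm divided by
    \<open>Suc M\<close>.\<close>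
  define n where "n = Suc (length w)"
  show "(\<lambda>M. 2 * real (length w) * (1 + ln (real (Suc M))) ^ Suc (length w) / real (Suc M)) \<longlonglongrightarrow> 0"
    unfolding n_def[symmetric] by real_asymp
  show "\<forall>\<^sub>F M in sequentially. 0 \<le> cf (Q_series M) (w @ [X]) - cf (P_series M) (w @ [X])"
    using Q_minus_P_le(1)[OF harm_le_ln] by simp
  show "\<forall>\<^sub>F M in sequentially. cf (Q_series M) (w @ [X]) - cf (P_series M) (w @ [X])
      \<le> 2 * real (length w) * (1 + ln (real (Suc M))) ^ Suc (length w) / real (Suc M)"
    using Q_minus_P_le(2)[OF harm_le_ln] by simp
qed simp

section \<open>Reduction to indices without ones\<close>

lemma finite_indices: "finite {ks. is_index ks \<and> sum_list ks = k}"
proof (rule finite_subset)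
  show "{ks. is_index ks \<and> sum_list ks = k} \<subseteq> {ks. set ks \<subseteq> {0..k} \<and> length ks \<le> k}"
  proof
    fix ks assume "ks \<in> {ks. is_index ks \<and> sum_list ks = k}"
    then have ks: "is_index ks" "sum_list ks = k" by auto
    have "length ks \<le> sum_list ks"
      using ks(1) by (induction ks) (auto simp: is_index_def)
    then show "ks \<in> {ks. set ks \<subseteq> {0..k} \<and> length ks \<le> k}"
      using ks member_le_sum_list by fastforce
  qed
  show "finite {ks. set ks \<subseteq> {0..k} \<and> length ks \<le> k}"
    by (rule finite_lists_length_le) simp
qed

lemma finite_Ige2: "finite (Ige2 k)"
  by (rule finite_subset[OF _ finite_indices[of k]]) (auto simp: Ige2_def is_index_def)

lemma finite_Iadm: "finite (Iadm k)"
  by (rule finite_subset[OF _ finite_indices[of k]]) (auto simp: Iadm_def admissible_def)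

lemma Ige2_subset_Iadm: "k > 0 \<Longrightarrow> Ige2 k \<subseteq> Iadm k"
proof
  fix ks assume k: "k > 0" and ks: "ks \<in> Ige2 k"
  then have "ks \<noteq> []" by (auto simp: Ige2_def)
  moreover from this have "last ks \<ge> 2" using ks by (simp add: Ige2_def)
  moreover have "is_index ks" using ks by (fastforce simp: Ige2_def is_index_def)
  ultimately show "ks \<in> Iadm k" using ks by (simp add: Ige2_def Iadm_def admissible_def)
qed

text \<open>The coefficients are the same for all cut-offs \<open>M\<close>, so that such a relation
  survives the limit.\<close>

definition mhs_span :: "nat \<Rightarrow> (nat \<Rightarrow> real) set" where
  "mhs_span k = {f. \<exists>c :: nat list \<Rightarrow> int. \<forall>M. f M = (\<Sum>l\<in>Ige2 k. of_int (c l) * mhs M l)}"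

lemma mhs_in_span:
  assumes "l \<in> Ige2 k"
  shows "(\<lambda>M. mhs M l) \<in> mhs_span k"
  unfolding mhs_span_def
proof (intro CollectI exI[of _ "\<lambda>l'. if l' = l then 1 else 0"] allI)
  fix M
  have "(\<Sum>l'\<in>Ige2 k. of_int (if l' = l then 1 else 0) * mhs M l')
      = (\<Sum>l'\<in>Ige2 k. if l' = l then mhs M l else 0)"
    by (intro sum.cong) auto
  then show "mhs M l = (\<Sum>l'\<in>Ige2 k. of_int (if l' = l then 1 else 0) * mhs M l')"
    using assms finite_Ige2 by simp
qed

lemma mhs_span_int_mult: "f \<in> mhs_span k \<Longrightarrow> (\<lambda>M. of_int a * f M) \<in> mhs_span k"
  unfolding mhs_span_def
proof clarify
  fix c :: "nat list \<Rightarrow> int"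
  assume "\<forall>M. f M = (\<Sum>l\<in>Ige2 k. of_int (c l) * mhs M l)"
  then show "\<exists>c :: nat list \<Rightarrow> int. \<forall>M. of_int a * f M = (\<Sum>l\<in>Ige2 k. of_int (c l) * mhs M l)"
    by (intro exI[of _ "\<lambda>l. a * c l"]) (simp add: sum_distrib_left mult.assoc)
qed

lemma mhs_span_sum:
  assumes "\<And>i. i \<in> I \<Longrightarrow> f i \<in> mhs_span k"
  shows "(\<lambda>M. \<Sum>i\<in>I. f i M) \<in> mhs_span k"
proof -
  have "\<forall>i\<in>I. \<exists>c :: nat list \<Rightarrow> int. \<forall>M. f i M = (\<Sum>l\<in>Ige2 k. of_int (c l) * mhs M l)"
    using assms by (simp add: mhs_span_def)
  then obtain c :: "'a \<Rightarrow> nat list \<Rightarrow> int"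
    where c: "\<And>i M. i \<in> I \<Longrightarrow> f i M = (\<Sum>l\<in>Ige2 k. of_int (c i l) * mhs M l)"
    by metis
  have "(\<Sum>i\<in>I. f i M) = (\<Sum>l\<in>Ige2 k. of_int (\<Sum>i\<in>I. c i l) * mhs M l)" for M
  proof -
    have "(\<Sum>i\<in>I. f i M) = (\<Sum>i\<in>I. \<Sum>l\<in>Ige2 k. of_int (c i l) * mhs M l)"
      by (intro sum.cong) (simp_all add: c)
    also have "\<dots> = (\<Sum>l\<in>Ige2 k. \<Sum>i\<in>I. of_int (c i l) * mhs M l)"
      by (rule sum.swap)
    finally show ?thesis by (simp add: sum_distrib_right)
  qed
  then show ?thesis
    unfolding mhs_span_def by (intro CollectI exI[of _ "\<lambda>l. \<Sum>i\<in>I. c i l"]) simp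
qed

text \<open>By \<open>mhs_Suc\<close>, appending the entry \<open>j\<close> to every index is
  summation against \<open>1 / Suc M ^ j\<close>; \<open>j \<ge> 2\<close> keeps the indices free of
  ones.\<close>

lemma mhs_span_antidifference:
  assumes "g \<in> mhs_span k" "j \<ge> 2"
  obtains F where "F \<in> mhs_span (k + j)" "F 0 = 0" "\<And>M. F (Suc M) - F M = g M / real (Suc M) ^ j"
proof -
  obtain c :: "nat list \<Rightarrow> int" where c: "\<And>M. g M = (\<Sum>l\<in>Ige2 k. of_int (c l) * mhs M l)"
    using assms(1) by (auto simp: mhs_span_def)
  define F where "F = (\<lambda>M. \<Sum>l\<in>Ige2 k. of_int (c l) * mhs M (l @ [j]))"
  have "F \<in> mhs_span (k + j)"
    unfolding F_def using assms(2)
    by (intro mhs_span_sum mhs_span_int_mult mhs_in_span) (auto simp: Ige2_def)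
  moreover have "F 0 = 0" by (simp add: F_def mhs_0)
  moreover have "F (Suc M) - F M = g M / real (Suc M) ^ j" for M
    by (simp add: F_def c mhs_Suc sum_subtractf[symmetric] distrib_left sum_divide_distrib)
  ultimately show thesis by (rule that)
qed

text \<open>Strong induction on the length. In \<open>Q_Suc\<close> every shorter word comes with an
  exponent of at least 2, so its term has an antidifference in the span. For nonempty
  \<open>w\<close> both sides are 0 at \<open>M = 0\<close>.\<close>

lemma Q_in_mhs_span:
  assumes "w = [] \<or> adm w"
  shows "(\<lambda>M. cf (Q_series M) w) \<in> mhs_span (length w)"
  using assms
proof (induction "length w" arbitrary: w rule: less_induct)
  case less
  show ?case
  proof (cases "w = []")
    case True
    have "[] \<in> Ige2 0" by (simp add: Ige2_def)
    from mhs_in_span[OF this] show ?thesis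
      using Q_part_Nil by (simp add: True Q_series_def Q_part_def)
  next
    case False
    with less have w: "adm w" by blast
    define U where "U = {u. length u + 2 \<le> length w \<and> (u = [] \<or> adm u)}"
    have "\<exists>F. F \<in> mhs_span (length w) \<and> F 0 = 0 \<and>
        (\<forall>M. F (Suc M) - F M = cf (Q_series M) u / real (Suc M) ^ (length w - length u))" if "u \<in> U" for u
    proof -
      have "(\<lambda>M. cf (Q_series M) u) \<in> mhs_span (length u)"
        using less.hyps[of u] that by (simp add: U_def)
      moreover have j: "length w - length u \<ge> 2" "length u + (length w - length u) = length w"
        using that by (auto simp: U_def)
      ultimately obtain F where "F \<in> mhs_span (length u + (length w - length u))" "F 0 = 0"
        "\<And>M. F (Suc M) - F M = cf (Q_series M) u / real (Suc M) ^ (length w - length u)"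
        using mhs_span_antidifference by blast
      then show ?thesis unfolding j(2) by blast
    qed
    then have "\<forall>u\<in>U. \<exists>F. F \<in> mhs_span (length w) \<and> F 0 = 0 \<and>
        (\<forall>M. F (Suc M) - F M = cf (Q_series M) u / real (Suc M) ^ (length w - length u))" by blast
    from bchoice[OF this] obtain F where F: "\<And>u. u \<in> U \<Longrightarrow> F u \<in> mhs_span (length w)" "\<And>u. u \<in> U \<Longrightarrow> F u 0 = 0"
      "\<And>u M. u \<in> U \<Longrightarrow> F u (Suc M) - F u M = cf (Q_series M) u / real (Suc M) ^ (length w - length u)"
      by blast
    have "\<forall>u. \<exists>a. tr_coef w u = of_int a"
      using tr_coef_Ints[of w] by (blast elim: Ints_cases)
    from choice[OF this] obtain t where t: "\<And>u. tr_coef w u = of_int (t u)" by blast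
    have "cf (Q_series M) w = (\<Sum>u\<in>U. of_int (t u) * F u M)" for M
    proof (induction M)
      case 0
      show ?case using F(2) False by (simp add: Q_series_def)
    next
      case (Suc M)
      have "cf (Q_series (Suc M)) w = cf (Q_series M) w + (\<Sum>u\<in>U. of_int (t u) * (F u (Suc M) - F u M))"
        unfolding Q_Suc[OF w] U_def[symmetric] t by (simp add: F(3))
      also have "\<dots> = (\<Sum>u\<in>U. of_int (t u) * F u (Suc M))"
        unfolding Suc by (simp add: sum.distrib[symmetric] right_diff_distrib)
      finally show ?case .
    qed
    then show ?thesis
      using F(1) by (simp add: mhs_span_sum mhs_span_int_mult)
  qed
qed

section \<open>Passage to the limit\<close>

lemma mhs_nonneg: "0 \<le> mhs M ks"
  unfolding mhs_def by (intro sum_nonneg prod_nonneg) auto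

lemma upto_tuples_mono: "M \<le> N \<Longrightarrow> upto_tuples M r \<subseteq> upto_tuples N r"
  by (auto simp: upto_tuples_def)

lemma incseq_mhs: "incseq (\<lambda>M. mhs M ks)"
  unfolding incseq_def mhs_def
  by (intro allI impI sum_mono2 finite_upto_tuples upto_tuples_mono prod_nonneg) auto

text \<open>All terms are nonnegative, and every finite set of tuples lies below some cut-off. So
  the limit bounds all finite sums; this yields summability, without which \<open>infsum\<close>
  would be 0 by default.\<close>

lemma mzv_eq_lim:
  assumes "(\<lambda>M. mhs M ks) \<longlonglongrightarrow> L"
  shows "mzv ks = L"
proof -
  let ?A = "{ns. length ns = length ks \<and> sorted_wrt (<) ns \<and> (\<forall>n\<in>set ns. n > 0)}"
  let ?f = "\<lambda>ns. \<Prod>i<length ks. 1 / real (ns ! i) ^ (ks ! i)"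
  have nonneg: "0 \<le> ?f ns" for ns by (intro prod_nonneg) auto
  have le: "sum ?f F \<le> L" if F: "finite F" "F \<subseteq> ?A" for F
  proof -
    \<comment> \<open>The largest entry occurring in \<open>F\<close>; the inserted 0 covers the
      case without entries.\<close>
    define M where "M = Max (insert 0 (\<Union>(set ` F)))"
    have "F \<subseteq> upto_tuples M (length ks)"
      using F by (auto simp: upto_tuples_def M_def intro!: Max_ge)
    then have "sum ?f F \<le> mhs M ks"
      unfolding mhs_def by (intro sum_mono2 finite_upto_tuples nonneg)
    also have "\<dots> \<le> L" by (rule incseq_le[OF incseq_mhs assms])
    finally show ?thesis .
  qed
  have summable: "?f summable_on ?A"
    using nonneg le by (intro nonneg_bdd_above_summable_on bdd_aboveI2[where M = L]) auto
  have "mzv ks \<le> L"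
    unfolding mzv_def by (rule infsum_le_finite_sums[OF summable le])
  moreover have "mhs M ks \<le> mzv ks" for M
    unfolding mhs_def mzv_def
    by (rule finite_sum_le_infsum[OF summable finite_upto_tuples]) (auto simp: upto_tuples_def nonneg)
  then have "L \<le> mzv ks"
    by (intro LIMSEQ_le_const2[OF assms]) auto
  ultimately show ?thesis by simp
qed

text \<open>Induction on the index: the sums of the shorter index are bounded, so the increments are
  dominated by a multiple of \<open>1 / Suc n ^ 2\<close>.\<close>

lemma mhs_ge2_convergent:
  assumes "\<forall>x\<in>set l. x \<ge> 2"
  shows "convergent (\<lambda>M. mhs M l)"
  using assms
proof (induction l rule: rev_induct)
  case (snoc k l)
  then have "Bseq (\<lambda>M. mhs M l)"
    by (intro convergent_imp_Bseq) auto
  then obtain B where B: "\<And>M. \<bar>mhs M l\<bar> \<le> B"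
    by (auto simp: Bseq_def)
  have eq: "mhs M (l @ [k]) = (\<Sum>n<M. mhs n l / real (Suc n) ^ k)" for M
    by (induction M) (simp_all add: mhs_0 mhs_Suc)
  have "summable (\<lambda>n. mhs n l / real (Suc n) ^ k)"
  proof (rule summable_comparison_test')
    show "summable (\<lambda>n. B * (1 / real (Suc n) ^ 2))"
      using inverse_power_summable[of 2, where ?'a = real]
        summable_Suc_iff[of "\<lambda>n. inverse (real n ^ 2)"]
      by (intro summable_mult) (simp add: inverse_eq_divide)
    fix n :: nat
    have "mhs n l / real (Suc n) ^ k \<le> B / real (Suc n) ^ k"
      using B[of n] by (intro divide_right_mono) auto
    also have "\<dots> \<le> B / real (Suc n) ^ 2"
      using B[of 0] snoc.prems by (intro divide_left_mono power_increasing) auto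
    finally show "norm (mhs n l / real (Suc n) ^ k) \<le> B * (1 / real (Suc n) ^ 2)"
      using mhs_nonneg[of n l] by simp
  qed
  then have "convergent (\<lambda>M. \<Sum>n<M. mhs n l / real (Suc n) ^ k)"
    by (simp only: summable_iff_convergent)
  then show ?case by (simp only: eq)
qed (simp add: convergent_const)

lemma mhs_ge2_tendsto:
  assumes "\<forall>x\<in>set l. x \<ge> 2"
  shows "(\<lambda>M. mhs M l) \<longlonglongrightarrow> mzv l"
  using mhs_ge2_convergent[OF assms] mzv_eq_lim unfolding convergent_def by metis

lemma index_word_props:
  assumes "admissible ks"
  shows "adm (index_word ks)" "length (index_word ks) = sum_list ks"
    "\<exists>w. index_word ks = w @ [X]"
proof -
  obtain ks' k where ks: "ks = ks' @ [k]" "k \<ge> 2"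
    using assms by (metis admissible_def append_butlast_last_id)
  then obtain j where j: "k = Suc (Suc j)" by (metis add_2_eq_Suc le_Suc_ex)
  have "index_word ks = (index_word ks' @ Y # replicate j X) @ [X]"
    by (simp add: index_word_def ks(1) j replicate_append_same)
  then show ex: "\<exists>w. index_word ks = w @ [X]" by blast
  have "hd (index_word ks) = Y"
    using assms by (cases ks) (auto simp: index_word_def admissible_def)
  then show "adm (index_word ks)" using ex by (auto simp: adm_def)
  have "is_index ks" using assms by (simp add: admissible_def)
  then show "length (index_word ks) = sum_list ks"
    by (induction ks) (auto simp: index_word_def is_index_def)
qed

text \<open>The limit of the \<open>Q_series\<close> coefficient is read off from its integral
  expansion. The \<open>P_series\<close> coefficient has the same limit and is the truncated sum of
  \<open>ks\<close>, whose convergence is obtained along the way.\<close>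

lemma mzv_expand:
  assumes "ks \<in> Iadm k"
  shows "\<exists>c :: nat list \<Rightarrow> int. mzv ks = (\<Sum>l\<in>Ige2 k. of_int (c l) * mzv l)"
proof -
  define w where "w = index_word ks"
  have ks: "admissible ks" "sum_list ks = k" using assms by (auto simp: Iadm_def)
  have adm: "adm w" and len: "length w = k"
    using index_word_props[OF ks(1)] ks(2) by (simp_all add: w_def)
  obtain v where v: "w = v @ [X]" using index_word_props(3)[OF ks(1)] w_def by blast
  obtain c :: "nat list \<Rightarrow> int" where c: "\<And>M. cf (Q_series M) w = (\<Sum>l\<in>Ige2 k. of_int (c l) * mhs M l)"
    using Q_in_mhs_span[of w] adm len by (auto simp: mhs_span_def)
  have "(\<lambda>M. \<Sum>l\<in>Ige2 k. of_int (c l) * mhs M l) \<longlonglongrightarrow> (\<Sum>l\<in>Ige2 k. of_int (c l) * mzv l)"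
    by (intro tendsto_sum tendsto_mult tendsto_const mhs_ge2_tendsto) (auto simp: Ige2_def)
  then have "(\<lambda>M. cf (Q_series M) w) \<longlonglongrightarrow> (\<Sum>l\<in>Ige2 k. of_int (c l) * mzv l)"
    by (simp only: c)
  from tendsto_diff[OF this Q_minus_P_tendsto_0[of v]]
  have "(\<lambda>M. cf (P_series M) w) \<longlonglongrightarrow> (\<Sum>l\<in>Ige2 k. of_int (c l) * mzv l)"
    by (simp add: v)
  moreover have "cf (P_series M) w = mhs M ks" for M
    using ks(1) by (simp add: w_def P_index_word admissible_def)
  ultimately show ?thesis using mzv_eq_lim by auto
qed

theorem mainTheorem1:
  fixes k :: nat
  assumes "k \<ge> 2"
  shows "(\<forall>ks\<in>Iadm k. \<exists>c :: nat list \<Rightarrow> int.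
            mzv ks = (\<Sum>l\<in>Ige2 k. of_int (c l) * mzv l))
         \<and> zspan (Iadm k) = zspan (Ige2 k)"
proof (intro conjI ballI equalityI subsetI)
  fix ks assume "ks \<in> Iadm k"
  then show "\<exists>c :: nat list \<Rightarrow> int. mzv ks = (\<Sum>l\<in>Ige2 k. of_int (c l) * mzv l)"
    by (rule mzv_expand)
next
  fix x assume "x \<in> zspan (Iadm k)"
  then obtain a :: "nat list \<Rightarrow> int" where x: "x = (\<Sum>ks\<in>Iadm k. of_int (a ks) * mzv ks)"
    by (auto simp: zspan_def)
  obtain c :: "nat list \<Rightarrow> nat list \<Rightarrow> int"
    where c: "\<And>ks. ks \<in> Iadm k \<Longrightarrow> mzv ks = (\<Sum>l\<in>Ige2 k. of_int (c ks l) * mzv l)"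
    using mzv_expand[of _ k] bchoice[of "Iadm k" "\<lambda>ks c. mzv ks = (\<Sum>l\<in>Ige2 k. of_int (c l) * mzv l)"]
    by blast
  have "x = (\<Sum>ks\<in>Iadm k. \<Sum>l\<in>Ige2 k. of_int (a ks * c ks l) * mzv l)"
    unfolding x by (intro sum.cong) (simp_all add: c sum_distrib_left mult.assoc)
  also have "\<dots> = (\<Sum>l\<in>Ige2 k. of_int (\<Sum>ks\<in>Iadm k. a ks * c ks l) * mzv l)"
    by (subst sum.swap) (simp add: sum_distrib_right)
  finally show "x \<in> zspan (Ige2 k)"
    unfolding zspan_def by (intro CollectI exI[of _ "\<lambda>l. \<Sum>ks\<in>Iadm k. a ks * c ks l"]) simp
next
  fix x assume "x \<in> zspan (Ige2 k)"
  then obtain a :: "nat list \<Rightarrow> int" where x: "x = (\<Sum>l\<in>Ige2 k. of_int (a l) * mzv l)"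
    by (auto simp: zspan_def)
  \<comment> \<open>For positive \<open>k\<close> the empty index is not in \<open>Ige2 k\<close>,
    so \<open>Ige2 k\<close> lies in \<open>Iadm k\<close> and the coefficients extend by 0.\<close>
  have "x = (\<Sum>l\<in>Iadm k. of_int (if l \<in> Ige2 k then a l else 0) * mzv l)"
    unfolding x using assms Ige2_subset_Iadm[of k] finite_Iadm
    by (intro sum.mono_neutral_cong_left) auto
  then show "x \<in> zspan (Iadm k)"
    unfolding zspan_def by (intro CollectI exI[of _ "\<lambda>l. if l \<in> Ige2 k then a l else 0"]) simp
qed

end
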